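(* Assume $I_-^{\mathcal{N}}<I$ and $I_-^{\mathcal{N}}\vee P_\xi=I$, let $\mathcal{N}_1=\{N\in\mathcal{N}:N\le I_-^{\mathcal{N}}\}$, and let $\psi:\mathcal{T}(\mathcal{N}_1)\oplus\mathbb{C}\to\mathcal{T}(\mathcal{N}_1)\oplus\mathbb{C}$ be a Lie automorphism. Then there exist a map $\epsilon$ of $\mathcal{T}(\mathcal{N}_1)$ onto itself which is either an (algebraic) isomorphism or the negative of an (algebraic) anti-isomorphism, a linear functional $\tau_2:\mathbb{C}\to\mathbb{C}$, a linear functional $\tau_1$ on $\mathcal{T}(\mathcal{N}_1)$ vanishing on the commutators of $\mathcal{T}(\mathcal{N}_1)$, and a linear functional $\tau$ on $\mathcal{T}(\mathcal{N}_1)\oplus\mathbb{C}$ vanishing on the commutators of $\mathcal{T}(\mathcal{N}_1)\oplus\mathbb{C}$, such that $$\psi=((\epsilon+\tau_1)\oplus\tau_2)+\tau,$$ that is, $\psi(A\oplus a)=\big((\epsilon(A)+\tau_1(A)I)\oplus\tau_2(a)\big)+\tau(A\oplus a)(I\oplus 1)$ for all $A\in\mathcal{T}(\mathcal{N}_1)$ and $a\in\mathbb{C}$.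
   Context: Let $\mathcal{H}$ be an infinite-dimensional separable complex Hilbert space and $\mathcal{N}$ a nest of projections on $\mathcal{H}$ (a strongly closed, totally ordered family of orthogonal projections containing $0$ and $I$) with at least four projections. Projections are identified with their ranges. Let $\xi\in\mathcal{H}$ be a separating vector for the von Neumann algebra $\mathcal{N}''$ (i.e. $T\in\mathcal{N}''$, $T\xi=0$ imply $T=0$), and let $P_\xi$ be the orthogonal projection onto $\mathbb{C}\xi$. Put $I_-^{\mathcal{N}}=\vee\{M\in\mathcal{N}:M<I\}$. $\mathcal{N}_1$ is regarded as a nest on the Hilbert space $I_-^{\mathcal{N}}\mathcal{H}$, and $\mathcal{T}(\mathcal{N}_1)$ is the nest algebra of all bounded operators on $I_-^{\mathcal{N}}\mathcal{H}$ leaving the range of every projection in $\mathcal{N}_1$ invariant. $\mathcal{T}(\mathcal{N}_1)\oplus\mathbb{C}$ is the direct sum algebra with coordinatewise operations and unit $I\oplus1$. Write $[A,B]=AB-BA$. A Lie automorphism of an associative algebra is a bijective linear map $\psi$ of the algebra onto itself with $\psi([A,B])=[\psi(A),\psi(B)]$ for all $A,B$. *)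

theory Defs
  imports "HOL-Analysis.Analysis"
begin

section \<open>Complex Hilbert spaces\<close>

text \<open>
  The real structure (norm, metric, topology, real inner product) is the library's; a complex
  inner product space adds a complex scalar multiplication extending the real one and a sesquilinear
  form, linear in its first argument, whose real part is the real inner product.  Hence
  \<open>norm x = sqrt (Re (cinner x x))\<close>, and positive definiteness is inherited from \<open>real_inner\<close>.
\<close>

class scaleC =
  fixes scaleC :: "complex \<Rightarrow> 'a \<Rightarrow> 'a"  (infixr "*\<^sub>C" 75)

class complex_vector = real_vector + scaleC +
  assumes scaleC_add_right: "a *\<^sub>C (x + y) = a *\<^sub>C x + a *\<^sub>C y"
    and scaleC_add_left: "(a + b) *\<^sub>C x = a *\<^sub>C x + b *\<^sub>C x"
    and scaleC_scaleC: "a *\<^sub>C (b *\<^sub>C x) = (a * b) *\<^sub>C x"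
    and scaleC_one: "1 *\<^sub>C x = x"
    and scaleR_scaleC: "r *\<^sub>R x = complex_of_real r *\<^sub>C x"

class complex_inner = complex_vector + real_inner +
  fixes cinner :: "'a \<Rightarrow> 'a \<Rightarrow> complex"
  assumes cinner_add_left: "cinner (x + y) z = cinner x z + cinner y z"
    and cinner_scaleC_left: "cinner (c *\<^sub>C x) y = c * cinner x y"
    and cinner_commute: "cinner y x = cnj (cinner x y)"
    and inner_cinner: "inner x y = Re (cinner x y)"

class complex_hilbert = complex_inner + complete_space

global_interpretation complex_vector: vector_space "scaleC :: complex \<Rightarrow> 'a::complex_vector \<Rightarrow> 'a"
  defines cspan = complex_vector.span
  by unfold_locales
    (simp_all add: scaleC_add_right scaleC_add_left scaleC_scaleC scaleC_one)

definition infinite_cdim :: "'a::complex_vector itself \<Rightarrow> bool" where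
  "infinite_cdim _ \<longleftrightarrow> \<not> (\<exists>B :: 'a set. finite B \<and> cspan B = UNIV)"

lemma norm_scaleC: "norm (c *\<^sub>C x) = cmod c * norm (x :: 'a::complex_inner)"
proof -
  have "cinner (c *\<^sub>C x) (c *\<^sub>C x) = c * cnj c * cinner x x"
    by (metis cinner_commute cinner_scaleC_left complex_cnj_mult mult.assoc complex_cnj_cnj)
  hence "inner (c *\<^sub>C x) (c *\<^sub>C x) = (cmod c)\<^sup>2 * inner x x"
    by (simp add: inner_cinner complex_norm_square [symmetric])
  thus ?thesis
    by (simp add: norm_eq_sqrt_inner real_sqrt_mult)
qed


section \<open>Complex vector space structure on scalars, pairs and bounded operators\<close>

instantiation complex :: complex_vector
begin
definition "scaleC c z = c * z" for c z :: complex
instance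
  by standard (simp_all add: scaleC_complex_def algebra_simps scaleR_conv_of_real)
end

instantiation prod :: (complex_vector, complex_vector) complex_vector
begin
definition "scaleC c p = (c *\<^sub>C fst p, c *\<^sub>C snd p)"
instance
  by standard
    (simp_all add: scaleC_prod_def scaleC_add_right scaleC_add_left scaleC_scaleC scaleC_one
      scaleR_scaleC prod_eq_iff)
end

lemma bounded_linear_scaleC: "bounded_linear (\<lambda>x :: 'a::complex_inner. c *\<^sub>C x)"
proof (rule bounded_linear_intro)
  show "c *\<^sub>C (r *\<^sub>R x) = r *\<^sub>R (c *\<^sub>C x)" for r and x :: 'a
    by (simp add: scaleR_scaleC scaleC_scaleC mult.commute)
  show "norm (c *\<^sub>C x) \<le> norm x * cmod c" for x :: 'a
    by (simp add: norm_scaleC mult.commute)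
qed (rule scaleC_add_right)

instantiation blinfun :: (real_normed_vector, complex_inner) complex_vector
begin
definition scaleC_blinfun :: "complex \<Rightarrow> ('a \<Rightarrow>\<^sub>L 'b) \<Rightarrow> ('a \<Rightarrow>\<^sub>L 'b)" where
  "scaleC_blinfun c T = Blinfun (\<lambda>x. c *\<^sub>C blinfun_apply T x)"

lemma blinfun_apply_scaleC [simp]:
  "blinfun_apply (c *\<^sub>C T) x = c *\<^sub>C blinfun_apply T x" for T :: "'a \<Rightarrow>\<^sub>L 'b"
  unfolding scaleC_blinfun_def
  by (subst bounded_linear_Blinfun_apply)
    (auto intro: bounded_linear_compose [OF bounded_linear_scaleC] blinfun.bounded_linear_right)

instance
  by standard
    (rule blinfun_eqI, simp add: blinfun.add_left blinfun.scaleR_left scaleC_add_right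
      scaleC_add_left scaleC_scaleC scaleC_one scaleR_scaleC)+
end

definition clinear_on :: "'a::complex_vector set \<Rightarrow> ('a \<Rightarrow> 'b::complex_vector) \<Rightarrow> bool" where
  "clinear_on S f \<longleftrightarrow>
     (\<forall>x\<in>S. \<forall>y\<in>S. f (x + y) = f x + f y) \<and> (\<forall>c. \<forall>x\<in>S. f (c *\<^sub>C x) = c *\<^sub>C f x)"


section \<open>Operators and projections\<close>

text \<open>
  The type \<open>'a \<Rightarrow>\<^sub>L 'a\<close> contains the real-linear bounded operators; \<open>bounded_ops\<close> singles out
  the complex-linear ones, that is, B(H).
\<close>

definition bounded_ops :: "('a::complex_inner \<Rightarrow>\<^sub>L 'a) set" where
  "bounded_ops = {T. clinear_on UNIV (blinfun_apply T)}"

definition ran :: "('a::real_normed_vector \<Rightarrow>\<^sub>L 'a) \<Rightarrow> 'a set" where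
  "ran T = range (blinfun_apply T)"

definition projections :: "('a::complex_inner \<Rightarrow>\<^sub>L 'a) set" where
  "projections =
     {P \<in> bounded_ops. P o\<^sub>L P = P \<and> (\<forall>x y. cinner (P x) y = cinner x (P y))}"

definition proj_le :: "('a::complex_inner \<Rightarrow>\<^sub>L 'a) \<Rightarrow> ('a \<Rightarrow>\<^sub>L 'a) \<Rightarrow> bool" where
  "proj_le P Q \<longleftrightarrow> ran P \<subseteq> ran Q"

definition proj_less :: "('a::complex_inner \<Rightarrow>\<^sub>L 'a) \<Rightarrow> ('a \<Rightarrow>\<^sub>L 'a) \<Rightarrow> bool" where
  "proj_less P Q \<longleftrightarrow> proj_le P Q \<and> P \<noteq> Q"

text \<open>The orthogonal projection onto a closed subspace (unspecified on other sets).\<close>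

definition proj_onto :: "'a::complex_inner set \<Rightarrow> ('a \<Rightarrow>\<^sub>L 'a)" where
  "proj_onto M = (THE P. P \<in> projections \<and> ran P = M)"

definition proj_Sup :: "('a::complex_inner \<Rightarrow>\<^sub>L 'a) set \<Rightarrow> ('a \<Rightarrow>\<^sub>L 'a)" where
  "proj_Sup S = proj_onto (closure (cspan (\<Union>P\<in>S. ran P)))"

definition proj_vec :: "'a::complex_inner \<Rightarrow> ('a \<Rightarrow>\<^sub>L 'a)" where
  "proj_vec \<xi> = proj_onto (cspan {\<xi>})"

definition commutant :: "('a::complex_inner \<Rightarrow>\<^sub>L 'a) set \<Rightarrow> ('a \<Rightarrow>\<^sub>L 'a) set" where
  "commutant S = {T \<in> bounded_ops. \<forall>A\<in>S. T o\<^sub>L A = A o\<^sub>L T}"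

definition separating :: "'a::complex_inner \<Rightarrow> ('a \<Rightarrow>\<^sub>L 'a) set \<Rightarrow> bool" where
  "separating \<xi> \<A> \<longleftrightarrow> (\<forall>T\<in>\<A>. blinfun_apply T \<xi> = 0 \<longrightarrow> T = 0)"


section \<open>Nests and nest algebras\<close>

definition nest :: "('a::complex_inner \<Rightarrow>\<^sub>L 'a) set \<Rightarrow> bool" where
  "nest \<N> \<longleftrightarrow>
     \<N> \<subseteq> projections \<and> closedin strong_operator_topology \<N> \<and>
     (\<forall>P\<in>\<N>. \<forall>Q\<in>\<N>. proj_le P Q \<or> proj_le Q P) \<and> 0 \<in> \<N> \<and> id_blinfun \<in> \<N>"

definition I_minus :: "('a::complex_inner \<Rightarrow>\<^sub>L 'a) set \<Rightarrow> ('a \<Rightarrow>\<^sub>L 'a)" where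
  "I_minus \<N> = proj_Sup {M \<in> \<N>. proj_less M id_blinfun}"

text \<open>
  The bounded operators on the Hilbert space \<open>ran E\<close>, for a projection \<open>E\<close>, are represented by
  their extensions to the whole space that vanish on the orthogonal complement of \<open>ran E\<close>, i.e. by
  the corner E B(H) E, whose unit is \<open>E\<close>.  That restriction to \<open>ran E\<close> is a bijection from this
  corner onto the bounded complex-linear self-maps of \<open>ran E\<close> is proved in
  \<open>bij_betw_ops_on_restrict\<close>; it is evidently compatible with sums, scalar multiples and products.
\<close>

definition ops_on :: "('a::complex_inner \<Rightarrow>\<^sub>L 'a) \<Rightarrow> ('a \<Rightarrow>\<^sub>L 'a) set" where
  "ops_on E = {T \<in> bounded_ops. E o\<^sub>L T = T \<and> T o\<^sub>L E = T}"

lemma bij_betw_ops_on_restrict: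
  assumes E: "E \<in> projections"
  shows "bij_betw (\<lambda>T. restrict (blinfun_apply T) (ran E)) (ops_on E)
    {f \<in> ran E \<rightarrow>\<^sub>E ran E. clinear_on (ran E) f \<and> (\<exists>K. \<forall>x\<in>ran E. norm (f x) \<le> norm x * K)}"
    (is "bij_betw ?r _ ?B")
proof -
  have EE: "blinfun_apply E (blinfun_apply E x) = blinfun_apply E x" for x
    using E by (metis (mono_tags, lifting) projections_def mem_Collect_eq blinfun_apply_blinfun_compose)
  have Eadd: "blinfun_apply E (x + y) = blinfun_apply E x + blinfun_apply E y" for x y
    by (simp add: blinfun.add_right)
  have Esc: "blinfun_apply E (c *\<^sub>C x) = c *\<^sub>C blinfun_apply E x" for c x
    using E by (auto simp: projections_def bounded_ops_def clinear_on_def)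
  have ranE: "x \<in> ran E \<longleftrightarrow> blinfun_apply E x = x" for x
    unfolding ran_def by (metis EE rangeE rangeI)
  have into: "?r T \<in> ?B" if T: "T \<in> ops_on E" for T
  proof -
    have ET: "blinfun_apply E (blinfun_apply T x) = blinfun_apply T x" for x
      using T by (metis (mono_tags, lifting) ops_on_def mem_Collect_eq blinfun_apply_blinfun_compose)
    have lin: "clinear_on UNIV (blinfun_apply T)"
      using T by (auto simp: ops_on_def bounded_ops_def)
    show ?thesis
      using lin norm_blinfun [of T] ET
      by (auto simp: clinear_on_def ranE Eadd Esc PiE_def extensional_def mult.commute
          intro!: exI [of _ "norm T"])
  qed
  have inj: "inj_on ?r (ops_on E)"
  proof (rule inj_onI, rule blinfun_eqI)
    fix S T x assume S: "S \<in> ops_on E" and T: "T \<in> ops_on E" and eq: "?r S = ?r T"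
    have "?r S (E x) = ?r T (E x)" by (simp only: eq)
    hence "blinfun_apply (S o\<^sub>L E) x = blinfun_apply (T o\<^sub>L E) x" by (simp add: ranE EE)
    thus "blinfun_apply S x = blinfun_apply T x"
      using S T by (metis (mono_tags, lifting) ops_on_def mem_Collect_eq)
  qed
  have surj: "f \<in> ?r ` ops_on E" if f: "f \<in> ?B" for f
  proof -
    from f obtain K where K: "\<And>x. x \<in> ran E \<Longrightarrow> norm (f x) \<le> norm x * K" by auto
    have fE: "E (f x) = f x" if "E x = x" for x using f that by (auto simp: ranE)
    have add: "f (E x + E y) = f (E x) + f (E y)" for x y
      using f by (auto simp: clinear_on_def ranE EE)
    have sc: "f (c *\<^sub>C E x) = c *\<^sub>C f (E x)" for c x
      using f by (auto simp: clinear_on_def ranE EE)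
    have bl: "bounded_linear (\<lambda>x. f (E x))"
    proof (rule bounded_linear_intro)
      show "norm (f (E x)) \<le> norm x * (norm E * \<bar>K\<bar>)" for x
      proof -
        have "norm (f (E x)) \<le> norm (E x) * K" by (rule K) (simp add: ranE EE)
        also have "\<dots> \<le> norm (E x) * \<bar>K\<bar>" by (simp add: mult_left_mono)
        also have "\<dots> \<le> (norm E * norm x) * \<bar>K\<bar>"
          by (rule mult_right_mono [OF norm_blinfun]) simp
        finally show ?thesis by (simp add: mult_ac)
      qed
    qed (simp_all add: Eadd add scaleR_scaleC Esc sc)
    define T where "T = Blinfun (\<lambda>x. f (E x))"
    have T: "blinfun_apply T x = f (E x)" for x
      unfolding T_def by (simp add: bounded_linear_Blinfun_apply [OF bl])
    have "T \<in> ops_on E"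
      by (auto simp: ops_on_def bounded_ops_def clinear_on_def T Eadd add Esc sc EE fE
          intro!: blinfun_eqI)
    moreover have "?r T = f"
      using f by (auto simp: fun_eq_iff T ranE restrict_def PiE_def extensional_def)
    ultimately show ?thesis by blast
  qed
  show ?thesis
    unfolding bij_betw_def using inj into surj by blast
qed

text \<open>The nest algebra of a family of projections below \<open>E\<close>, regarded as a nest on \<open>ran E\<close>.\<close>

definition nest_algebra :: "('a::complex_inner \<Rightarrow>\<^sub>L 'a) \<Rightarrow> ('a \<Rightarrow>\<^sub>L 'a) set \<Rightarrow> ('a \<Rightarrow>\<^sub>L 'a) set" where
  "nest_algebra E \<M> = {T \<in> ops_on E. \<forall>N\<in>\<M>. blinfun_apply T ` ran N \<subseteq> ran N}"


section \<open>Lie maps, isomorphisms and anti-isomorphisms\<close>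

text \<open>
  An algebra is given by a carrier set in a complex vector space and a multiplication \<open>m\<close>.
\<close>

definition commutator :: "('v::ab_group_add \<Rightarrow> 'v \<Rightarrow> 'v) \<Rightarrow> 'v \<Rightarrow> 'v \<Rightarrow> 'v" where
  "commutator m A B = m A B - m B A"

definition lie_automorphism ::
  "('v::complex_vector \<Rightarrow> 'v \<Rightarrow> 'v) \<Rightarrow> 'v set \<Rightarrow> ('v \<Rightarrow> 'v) \<Rightarrow> bool" where
  "lie_automorphism m S \<psi> \<longleftrightarrow>
     bij_betw \<psi> S S \<and> clinear_on S \<psi> \<and>
     (\<forall>A\<in>S. \<forall>B\<in>S. \<psi> (commutator m A B) = commutator m (\<psi> A) (\<psi> B))"

definition alg_automorphism ::
  "('v::complex_vector \<Rightarrow> 'v \<Rightarrow> 'v) \<Rightarrow> 'v set \<Rightarrow> ('v \<Rightarrow> 'v) \<Rightarrow> bool" where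
  "alg_automorphism m S \<phi> \<longleftrightarrow>
     bij_betw \<phi> S S \<and> clinear_on S \<phi> \<and> (\<forall>A\<in>S. \<forall>B\<in>S. \<phi> (m A B) = m (\<phi> A) (\<phi> B))"

definition alg_anti_automorphism ::
  "('v::complex_vector \<Rightarrow> 'v \<Rightarrow> 'v) \<Rightarrow> 'v set \<Rightarrow> ('v \<Rightarrow> 'v) \<Rightarrow> bool" where
  "alg_anti_automorphism m S \<phi> \<longleftrightarrow>
     bij_betw \<phi> S S \<and> clinear_on S \<phi> \<and> (\<forall>A\<in>S. \<forall>B\<in>S. \<phi> (m A B) = m (\<phi> B) (\<phi> A))"

definition vanishes_on_commutators ::
  "('v::ab_group_add \<Rightarrow> 'v \<Rightarrow> 'v) \<Rightarrow> 'v set \<Rightarrow> ('v \<Rightarrow> complex) \<Rightarrow> bool" where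
  "vanishes_on_commutators m S f \<longleftrightarrow> (\<forall>A\<in>S. \<forall>B\<in>S. f (commutator m A B) = 0)"

text \<open>
  The direct sum of an operator algebra \<open>S\<close> with the scalars has carrier \<open>S \<times> UNIV\<close> and the
  following multiplication; its linear structure is the one of the product type.
\<close>

definition dsum_mult ::
  "('a::real_normed_vector \<Rightarrow>\<^sub>L 'a) \<times> complex \<Rightarrow> ('a \<Rightarrow>\<^sub>L 'a) \<times> complex
    \<Rightarrow> ('a \<Rightarrow>\<^sub>L 'a) \<times> complex" where
  "dsum_mult x y = (fst x o\<^sub>L fst y, snd x * snd y)"

end

theory Submission
  imports Defs
begin

text \<open>
  Call an idempotent \<open>f\<close> of an algebra \<open>S\<close> triangular if \<open>(1 - f) S f = 0\<close>.  Up to scalars these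
  are exactly the nonscalar \<open>e\<close> with \<open>(ad e)\<^sup>2 = ad e\<close>, so a Lie automorphism \<open>\<theta>\<close> sends a
  triangular idempotent \<open>n\<close> to \<open>f + c\<close> with \<open>f\<close> triangular, maps \<open>n S (1 - n)\<close> onto
  \<open>f S (1 - f)\<close> and respects the block diagonals.  For \<open>a \<in> n S n\<close> and \<open>x \<in> n S (1 - n)\<close> we have
  \<open>[a, [a, x]] = [a\<^sup>2, x]\<close>; applying \<open>\<theta>\<close> gives a linear relation between left and right
  multiplications on \<open>f S (1 - f)\<close>, which in a nest algebra contains all rank-one operators
  \<open>f (x \<otimes> z) (1 - f)\<close>.  This forces one of the two diagonal blocks of \<open>\<theta> a\<close> to be scalar, and
  likewise for the other corner.  Removing these scalars from \<open>\<theta>\<close> yields an automorphism or the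
  negative of an anti-automorphism, according to which blocks are scalar.  A Lie automorphism of
  the direct sum with the scalars induces one of the nest algebra up to central summands.
\<close>

text \<open>The corner \<open>f S (\<one> - f)\<close> is the 1-eigenspace of \<open>ad f\<close>,
  so brackets alone can describe it; a product of a diagonal with a corner element is also a
  bracket, because the opposite product is 0. Products inside a diagonal are not brackets and are
  recovered from their faithful action on the corner. Each diagonal block of \<open>n\<close> has
  two alternatives, which makes four cases, and only two of them lead to a map of the desired kind.
  In the other two both diagonals would act on the corner of \<open>f\<close> from one side only.
  Then the image of \<open>x \<mapsto> a x b\<close> would again be a bracket with a single element,
  which the independence of left and right multiplications permits only if a whole diagonal is
  scalar. In the direct sum the obstacle is the two-dimensional centre: the first coordinate of
  \<open>\<psi>\<close> may annihilate the unit of the nest algebra and then is not injective. A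
  multiple of the second coordinate is therefore added to it before the theory applies. Four
  projections guarantee a member of the nest other than 0, \<open>I\<close> and \<open>I_-\<close>,
  and this member serves as the first triangular idempotent.\<close>

section \<open>Lie automorphisms of triangular algebras\<close>

text \<open>
  Scalars are only required to commute with the multiplication on \<open>S\<close>, because
  \<open>A o\<^sub>L c *\<^sub>C B = c *\<^sub>C (A o\<^sub>L B)\<close> fails for real-linear \<open>A\<close>.
\<close>

locale complex_algebra =
  fixes mult :: "'v::complex_vector \<Rightarrow> 'v \<Rightarrow> 'v" (infixl "\<odot>" 70)
    and S :: "'v set"
    and unit :: 'v ("\<one>")
  assumes assoc: "x \<odot> y \<odot> z = x \<odot> (y \<odot> z)"
    and add_left: "(x + y) \<odot> z = x \<odot> z + y \<odot> z"
    and add_right: "z \<odot> (x + y) = z \<odot> x + z \<odot> y"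
    and scale_left: "x \<in> S \<Longrightarrow> y \<in> S \<Longrightarrow> (c *\<^sub>C x) \<odot> y = c *\<^sub>C (x \<odot> y)"
    and scale_right: "x \<in> S \<Longrightarrow> y \<in> S \<Longrightarrow> x \<odot> (c *\<^sub>C y) = c *\<^sub>C (x \<odot> y)"
    and unit_mem [simp]: "\<one> \<in> S"
    and add_mem [simp]: "x \<in> S \<Longrightarrow> y \<in> S \<Longrightarrow> x + y \<in> S"
    and scale_mem [simp]: "x \<in> S \<Longrightarrow> c *\<^sub>C x \<in> S"
    and mult_mem [simp]: "x \<in> S \<Longrightarrow> y \<in> S \<Longrightarrow> x \<odot> y \<in> S"
    and unit_left [simp]: "x \<in> S \<Longrightarrow> \<one> \<odot> x = x"
    and unit_right [simp]: "x \<in> S \<Longrightarrow> x \<odot> \<one> = x"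
begin

lemma mult_zero_left [simp]: "0 \<odot> x = 0"
  using add_left [of 0 0 x] by simp

lemma mult_zero_right [simp]: "x \<odot> 0 = 0"
  using add_right [of x 0 0] by simp

lemma minus_left: "(- x) \<odot> y = - (x \<odot> y)"
  using add_left [of x "- x" y] by (simp add: eq_neg_iff_add_eq_0 add.commute)

lemma minus_right: "x \<odot> (- y) = - (x \<odot> y)"
  using add_right [of x y "- y"] by (simp add: eq_neg_iff_add_eq_0 add.commute)

lemma diff_left: "(x - y) \<odot> z = x \<odot> z - y \<odot> z"
  using add_left [of x "- y" z] by (simp add: minus_left)

lemma diff_right: "z \<odot> (x - y) = z \<odot> x - z \<odot> y"
  using add_right [of z x "- y"] by (simp add: minus_right)

lemma uminus_mem [simp]: "x \<in> S \<Longrightarrow> - x \<in> S"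
  using scale_mem [of x "- 1"] by (simp add: complex_vector.scale_minus_left scaleC_one)

lemma diff_mem [simp]: "x \<in> S \<Longrightarrow> y \<in> S \<Longrightarrow> x - y \<in> S"
  using add_mem [of x "- y"] by simp

lemma zero_mem [simp]: "0 \<in> S"
  using diff_mem [OF unit_mem unit_mem] by simp

lemmas mult_simps = add_left add_right diff_left diff_right minus_left minus_right
  scale_left scale_right

abbreviation bracket :: "'v \<Rightarrow> 'v \<Rightarrow> 'v" ("\<lbrakk>_, _\<rbrakk>") where
  "\<lbrakk>x, y\<rbrakk> \<equiv> commutator mult x y"

lemma bracket_eq: "\<lbrakk>x, y\<rbrakk> = x \<odot> y - y \<odot> x"
  by (simp add: commutator_def)

lemma bracket_mem [simp]: "x \<in> S \<Longrightarrow> y \<in> S \<Longrightarrow> \<lbrakk>x, y\<rbrakk> \<in> S"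
  by (simp add: bracket_eq)

lemma bracket_shift:
  assumes "x \<in> S" "y \<in> S"
  shows "\<lbrakk>x + c *\<^sub>C \<one>, y\<rbrakk> = \<lbrakk>x, y\<rbrakk>" "\<lbrakk>y, x + c *\<^sub>C \<one>\<rbrakk> = \<lbrakk>y, x\<rbrakk>"
  using assms by (simp_all add: bracket_eq mult_simps)

definition corner :: "'v \<Rightarrow> 'v set" where
  "corner f = {y \<in> S. f \<odot> y = y \<and> y \<odot> f = 0}"

definition tri_idem :: "'v \<Rightarrow> bool" where
  "tri_idem f \<longleftrightarrow> f \<in> S \<and> f \<odot> f = f \<and> f \<noteq> 0 \<and> f \<noteq> \<one> \<and> (\<forall>y\<in>S. f \<odot> y \<odot> f = y \<odot> f)"

lemma tri_idemD:
  assumes "tri_idem f"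
  shows "f \<in> S" "f \<odot> f = f" "f \<noteq> 0" "\<one> - f \<noteq> 0" "y \<in> S \<Longrightarrow> f \<odot> (y \<odot> f) = y \<odot> f"
  using assms by (auto simp: tri_idem_def assoc)

lemma cornerD:
  assumes "y \<in> corner f"
  shows "y \<in> S" "f \<odot> y = y" "y \<odot> f = 0"
  using assms by (auto simp: corner_def)

end

text \<open>
  The first two axioms say that the bimodule \<open>f S (\<one> - f)\<close> has only the trivial linear
  dependences between its left and right multiplications.
\<close>

locale triangular_algebra = complex_algebra +
  assumes corner_bilinear:
      "\<lbrakk>tri_idem f; p \<in> S; b \<in> S; c \<in> S; d \<in> S;
        \<And>y. y \<in> corner f \<Longrightarrow> p \<odot> y + b \<odot> y \<odot> c + y \<odot> d = 0\<rbrakk>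
       \<Longrightarrow> (\<exists>s. b \<odot> f = s *\<^sub>C f) \<or> (\<exists>s. (\<one> - f) \<odot> c = s *\<^sub>C (\<one> - f))"
    and corner_linear:
      "\<lbrakk>tri_idem f; p \<in> S; d \<in> S; \<And>y. y \<in> corner f \<Longrightarrow> p \<odot> y = y \<odot> d\<rbrakk>
       \<Longrightarrow> \<exists>s. p \<odot> f = s *\<^sub>C f \<and> (\<one> - f) \<odot> d = s *\<^sub>C (\<one> - f)"
    and tri_idem_exists: "\<exists>f. tri_idem f"
begin

text \<open>The case \<open>d = 0\<close> of \<open>corner_linear\<close>: the scalar shared by both
  sides must be 0, as \<open>\<one> - f\<close> is nonzero.\<close>

lemma corner_faithful_left:
  assumes f: "tri_idem f" and p: "p \<in> S" and "\<And>y. y \<in> corner f \<Longrightarrow> p \<odot> y = 0"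
  shows "p \<odot> f = 0"
proof -
  obtain s where s: "p \<odot> f = s *\<^sub>C f" "(\<one> - f) \<odot> 0 = s *\<^sub>C (\<one> - f)"
    using corner_linear [OF f p zero_mem] assms(3) by auto
  have "s = 0"
    using s(2) tri_idemD(4) [OF f] by (simp add: complex_vector.scale_eq_0_iff)
  with s(1) show ?thesis by (simp add: complex_vector.scale_eq_0_iff)
qed

lemma corner_faithful_right:
  assumes f: "tri_idem f" and d: "d \<in> S" and "\<And>y. y \<in> corner f \<Longrightarrow> y \<odot> d = 0"
  shows "(\<one> - f) \<odot> d = 0"
proof -
  obtain s where s: "0 \<odot> f = s *\<^sub>C f" "(\<one> - f) \<odot> d = s *\<^sub>C (\<one> - f)"
    using corner_linear [OF f zero_mem d] assms(3) by auto
  have "s = 0"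
    using s(1) tri_idemD(3) [OF f] by (simp add: complex_vector.scale_eq_0_iff)
  with s(2) show ?thesis by (simp add: complex_vector.scale_eq_0_iff)
qed

text \<open>Left and right multiplication by a central \<open>t\<close> agree on a corner, so
  \<open>corner_linear\<close> puts the same scalar on both diagonal blocks; commuting with
  \<open>f\<close> reassembles \<open>t\<close> from them.\<close>

lemma central_imp_scalar:
  assumes t: "t \<in> S" and comm: "\<And>y. y \<in> S \<Longrightarrow> \<lbrakk>t, y\<rbrakk> = 0"
  shows "\<exists>s. t = s *\<^sub>C \<one>"
proof -
  have comm': "t \<odot> y = y \<odot> t" if "y \<in> S" for y
    using comm [OF that] by (simp add: bracket_eq)
  obtain f where f: "tri_idem f"
    using tri_idem_exists by blast
  note [simp] = tri_idemD(1) [OF f]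
  obtain s where s: "t \<odot> f = s *\<^sub>C f" "(\<one> - f) \<odot> t = s *\<^sub>C (\<one> - f)"
    using corner_linear [OF f t t] comm' cornerD(1) by blast
  have "t = t \<odot> f + (\<one> - f) \<odot> t"
    using t comm' [of f] by (simp add: mult_simps)
  also have "\<dots> = s *\<^sub>C \<one>"
    by (simp add: s complex_vector.scale_right_diff_distrib)
  finally show ?thesis ..
qed

section \<open>Elements whose inner derivation is idempotent\<close>

lemma tri_idem_not_scalar:
  assumes "tri_idem f"
  shows "f \<noteq> c *\<^sub>C \<one>"
proof
  assume fc: "f = c *\<^sub>C \<one>"
  note f = tri_idemD [OF assms]
  have "c *\<^sub>C f = f \<odot> f"
    using f(1) by (subst (2) fc) (simp add: mult_simps)
  hence "(c - 1) *\<^sub>C f = 0"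
    by (simp add: f complex_vector.scale_left_diff_distrib scaleC_one)
  hence "c = 1"
    using f(3) by (simp add: complex_vector.scale_eq_0_iff)
  with fc f(4) show False
    by (simp add: scaleC_one)
qed

text \<open>On the corner of a known \<open>n\<close> the hypothesis reads
  \<open>(e^2 - e) y - 2 e y e + y (e^2 + e) = 0\<close>, so by \<open>corner_bilinear\<close> one
  diagonal block of \<open>e\<close> is scalar. Subtracting that scalar gives \<open>u\<close> with
  \<open>u n = 0\<close> or \<open>(\<one> - n) u = 0\<close>, and the relation collapses to
  \<open>u^2 = - u\<close> or \<open>u^2 = u\<close>.\<close>

lemma ad_idempotent_imp_tri_idem:
  assumes e: "e \<in> S" and ad: "\<And>y. y \<in> S \<Longrightarrow> \<lbrakk>e, \<lbrakk>e, y\<rbrakk>\<rbrakk> = \<lbrakk>e, y\<rbrakk>"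
    and not_scalar: "\<And>c. e \<noteq> c *\<^sub>C \<one>"
  shows "\<exists>f c. tri_idem f \<and> e = f + c *\<^sub>C \<one>"
proof -
  obtain n where n: "tri_idem n"
    using tri_idem_exists by blast
  note nD = tri_idemD [OF n] and [simp] = tri_idemD(1) [OF n] e
  have "(e \<odot> e - e) \<odot> y + (- (e + e)) \<odot> y \<odot> e + y \<odot> (e \<odot> e + e) = 0" if "y \<in> corner n" for y
    using ad [of y] cornerD [OF that] by (simp add: bracket_eq mult_simps assoc algebra_simps)
  from corner_bilinear [OF n _ _ _ _ this]
  consider s where "(- (e + e)) \<odot> n = s *\<^sub>C n" | s where "(\<one> - n) \<odot> e = s *\<^sub>C (\<one> - n)"
    by auto
  hence "\<exists>f c. f \<in> S \<and> f \<odot> f = f \<and> e = f + c *\<^sub>C \<one>"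
  proof cases
    case (1 s)
    \<comment> \<open>Undoes the factor -2, which enters as \<open>- (e + e)\<close>.\<close>
    define l where "l = - s / 2"
    have "- (e \<odot> n + e \<odot> n) = s *\<^sub>C n"
      using 1 by (simp add: mult_simps)
    hence "e \<odot> n + e \<odot> n = - (s *\<^sub>C n)"
      by (metis minus_minus)
    hence "2 *\<^sub>C (e \<odot> n) = (- s) *\<^sub>C n"
      using complex_vector.scale_left_distrib [of 1 1 "e \<odot> n"] by simp
    hence "(1/2) *\<^sub>C (2 *\<^sub>C (e \<odot> n)) = (1/2) *\<^sub>C ((- s) *\<^sub>C n)" by simp
    hence en: "e \<odot> n = l *\<^sub>C n"
      by (simp add: l_def)
    define u where "u = e - l *\<^sub>C \<one>"
    have u [simp]: "u \<in> S" by (simp add: u_def)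
    have eu: "e = u + l *\<^sub>C \<one>" by (simp add: u_def)
    have adu: "\<lbrakk>u, \<lbrakk>u, y\<rbrakk>\<rbrakk> = \<lbrakk>u, y\<rbrakk>" if "y \<in> S" for y
      using ad [OF that] that unfolding eu by (simp add: bracket_shift)
    have un: "u \<odot> n = 0"
      by (simp add: u_def mult_simps en)
    \<comment> \<open>As \<open>u\<close> annihilates \<open>n\<close> and the corner from the left,
      the double bracket of \<open>u\<close> with either keeps only the term with \<open>u^2\<close>
      on the right.\<close>
    define w where "w = u \<odot> u + u"
    have w [simp]: "w \<in> S" by (simp add: w_def)
    have "n \<odot> w = 0"
      using adu [of n] un by (simp add: bracket_eq mult_simps assoc w_def flip: assoc)
    moreover have "y \<odot> w = 0" if "y \<in> corner n" for y
    proof -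
      note y = cornerD [OF that]
      have uy: "u \<odot> y = 0"
        by (metis y(2) un assoc mult_zero_left)
      have uyx: "u \<odot> (y \<odot> x) = 0" for x
        by (metis uy assoc mult_zero_left)
      show ?thesis
        using adu [OF y(1)] by (simp add: bracket_eq mult_simps w_def uy uyx assoc)
    qed
    hence "(\<one> - n) \<odot> w = 0"
      by (intro corner_faithful_right [OF n w])
    ultimately have "w = 0"
      by (simp add: mult_simps)
    hence "(\<one> + u) \<odot> (\<one> + u) = \<one> + u"
      by (simp add: mult_simps w_def add.commute)
    moreover have "e = (\<one> + u) + (l - 1) *\<^sub>C \<one>"
      by (simp add: u_def complex_vector.scale_left_diff_distrib scaleC_one)
    ultimately show ?thesis
      by (intro exI [of _ "\<one> + u"] exI [of _ "l - 1"]) simp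
  next
    case (2 s)
    define u where "u = e - s *\<^sub>C \<one>"
    have u [simp]: "u \<in> S" by (simp add: u_def)
    have eu: "e = u + s *\<^sub>C \<one>" by (simp add: u_def)
    have adu: "\<lbrakk>u, \<lbrakk>u, y\<rbrakk>\<rbrakk> = \<lbrakk>u, y\<rbrakk>" if "y \<in> S" for y
      using ad [OF that] that unfolding eu by (simp add: bracket_shift)
    have un: "(\<one> - n) \<odot> u = 0"
      using 2 by (simp add: u_def mult_simps complex_vector.scale_right_diff_distrib)
    \<comment> \<open>Mirror image: corner elements annihilate \<open>u\<close> from the left, so
      only the term with \<open>u^2\<close> on the left survives.\<close>
    define w where "w = u \<odot> u - u"
    have w [simp]: "w \<in> S" by (simp add: w_def)
    have nu: "n \<odot> u = u"
      using un by (simp add: mult_simps)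
    have nux: "n \<odot> (u \<odot> x) = u \<odot> x" for x
      by (metis nu assoc)
    have "w \<odot> (\<one> - n) = 0"
      using adu [of n] by (simp add: bracket_eq mult_simps w_def nu nux assoc algebra_simps)
    moreover have "w \<odot> y = 0" if "y \<in> corner n" for y
    proof -
      note y = cornerD [OF that]
      have uy: "y \<odot> u = 0"
        by (metis y(3) nu assoc mult_zero_left)
      have uyx: "y \<odot> (u \<odot> x) = 0" for x
        by (metis uy assoc mult_zero_left)
      show ?thesis
        using adu [OF y(1)] by (simp add: bracket_eq mult_simps w_def uy uyx assoc)
    qed
    hence "w \<odot> n = 0"
      by (intro corner_faithful_left [OF n w])
    ultimately have "w = 0"
      by (simp add: mult_simps)
    thus ?thesis
      by (intro exI [of _ u] exI [of _ s]) (simp add: w_def eu)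
  qed
  then obtain f c where f: "f \<in> S" "f \<odot> f = f" "e = f + c *\<^sub>C \<one>" by blast
  have "tri_idem f"
    unfolding tri_idem_def
  proof (intro conjI ballI f)
    show "f \<noteq> 0" "f \<noteq> \<one>"
      using not_scalar [of c] not_scalar [of "c + 1"]
      by (auto simp: f complex_vector.scale_left_distrib scaleC_one)
    fix y assume y: "y \<in> S"
    have ff: "f \<odot> (f \<odot> x) = f \<odot> x" for x
      by (metis f(2) assoc)
    \<comment> \<open>Expanded with \<open>f^2 = f\<close>, this leaves
      \<open>2 f y f = 2 y f\<close>, which is triangularity.\<close>
    have "\<lbrakk>f, \<lbrakk>f, y\<rbrakk>\<rbrakk> = \<lbrakk>f, y\<rbrakk>"
      using ad [OF y] y f(1) by (simp add: f(3) bracket_shift)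
    hence "2 *\<^sub>R (f \<odot> (y \<odot> f)) = 2 *\<^sub>R (y \<odot> f)"
      by (simp add: bracket_eq mult_simps assoc f ff scaleR_2 algebra_simps)
    thus "f \<odot> y \<odot> f = y \<odot> f"
      by (simp add: assoc)
  qed
  with f(3) show ?thesis by blast
qed

end

section \<open>Peirce blocks of a triangular idempotent\<close>

context complex_algebra
begin

definition upper_diag :: "'v \<Rightarrow> 'v set" where
  "upper_diag f = {a \<in> S. f \<odot> a = a \<and> a \<odot> f = a}"

definition lower_diag :: "'v \<Rightarrow> 'v set" where
  "lower_diag f = {b \<in> S. f \<odot> b = 0 \<and> b \<odot> f = 0}"

lemma upper_diagD:
  assumes "a \<in> upper_diag f"
  shows "a \<in> S" "f \<odot> a = a" "a \<odot> f = a"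
  using assms by (auto simp: upper_diag_def)

lemma lower_diagD:
  assumes "b \<in> lower_diag f"
  shows "b \<in> S" "f \<odot> b = 0" "b \<odot> f = 0"
  using assms by (auto simp: lower_diag_def)

text \<open>A description of the corner by brackets only, hence one that a Lie automorphism can
  transport.\<close>

lemma corner_iff_bracket:
  assumes "tri_idem f"
  shows "y \<in> corner f \<longleftrightarrow> y \<in> S \<and> \<lbrakk>f, y\<rbrakk> = y"
proof
  assume "y \<in> corner f"
  thus "y \<in> S \<and> \<lbrakk>f, y\<rbrakk> = y"
    by (simp add: corner_def bracket_eq)
next
  assume y: "y \<in> S \<and> \<lbrakk>f, y\<rbrakk> = y"
  note f = tri_idemD [OF assms]
  have "y \<odot> f = (f \<odot> y - y \<odot> f) \<odot> f"
    using y by (simp add: bracket_eq)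
  also have "\<dots> = 0"
    using y by (simp add: mult_simps assoc f)
  finally show "y \<in> corner f"
    using y by (simp add: corner_def bracket_eq)
qed

text \<open>Triangularity leaves three blocks, hence nine block products, five of which vanish. The
  product \<open>M\<close> is abstract so that the same computation serves automorphisms and, with
  the opposite product, anti-automorphisms.\<close>

lemma mult_eq_by_blocks:
  fixes M :: "'v \<Rightarrow> 'v \<Rightarrow> 'v" and \<phi> :: "'v \<Rightarrow> 'v"
  assumes n: "tri_idem n"
    and M_left: "\<And>x y z. M (x + y) z = M x z + M y z"
    and M_right: "\<And>x y z. M z (x + y) = M z x + M z y"
    and add: "\<And>x y. x \<in> S \<Longrightarrow> y \<in> S \<Longrightarrow> \<phi> (x + y) = \<phi> x + \<phi> y"
    and uu: "\<And>a a'. a \<in> upper_diag n \<Longrightarrow> a' \<in> upper_diag n \<Longrightarrow> \<phi> (a \<odot> a') = M (\<phi> a) (\<phi> a')"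
    and uc: "\<And>a x. a \<in> upper_diag n \<Longrightarrow> x \<in> corner n \<Longrightarrow> \<phi> (a \<odot> x) = M (\<phi> a) (\<phi> x)"
    and cl: "\<And>x b. x \<in> corner n \<Longrightarrow> b \<in> lower_diag n \<Longrightarrow> \<phi> (x \<odot> b) = M (\<phi> x) (\<phi> b)"
    and ll: "\<And>b b'. b \<in> lower_diag n \<Longrightarrow> b' \<in> lower_diag n \<Longrightarrow> \<phi> (b \<odot> b') = M (\<phi> b) (\<phi> b')"
    and ul: "\<And>a b. a \<in> upper_diag n \<Longrightarrow> b \<in> lower_diag n \<Longrightarrow> M (\<phi> a) (\<phi> b) = 0"
    and cu: "\<And>x a. x \<in> corner n \<Longrightarrow> a \<in> upper_diag n \<Longrightarrow> M (\<phi> x) (\<phi> a) = 0"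
    and cc: "\<And>x x'. x \<in> corner n \<Longrightarrow> x' \<in> corner n \<Longrightarrow> M (\<phi> x) (\<phi> x') = 0"
    and lu: "\<And>b a. b \<in> lower_diag n \<Longrightarrow> a \<in> upper_diag n \<Longrightarrow> M (\<phi> b) (\<phi> a) = 0"
    and lc: "\<And>b x. b \<in> lower_diag n \<Longrightarrow> x \<in> corner n \<Longrightarrow> M (\<phi> b) (\<phi> x) = 0"
    and s: "s \<in> S" and t: "t \<in> S"
  shows "\<phi> (s \<odot> t) = M (\<phi> s) (\<phi> t)"
proof -
  note nD = tri_idemD [OF n] and [simp] = tri_idemD(1) [OF n]
  have nn: "n \<odot> (n \<odot> x) = n \<odot> x" for x
    by (metis nD(2) assoc)
  have nxn: "n \<odot> (x \<odot> (n \<odot> y)) = x \<odot> (n \<odot> y)" if "x \<in> S" for x y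
    by (metis nD(5) [OF that] assoc)
  have blocks: "\<exists>a x b. a \<in> upper_diag n \<and> x \<in> corner n \<and> b \<in> lower_diag n \<and> t = a + x + b"
    if t: "t \<in> S" for t
  proof (intro exI conjI)
    show "n \<odot> t \<odot> n \<in> upper_diag n" "n \<odot> t \<odot> (\<one> - n) \<in> corner n"
      "(\<one> - n) \<odot> t \<odot> (\<one> - n) \<in> lower_diag n"
      using t by (simp_all add: upper_diag_def corner_def lower_diag_def mult_simps assoc nD nn)
    show "t = n \<odot> t \<odot> n + n \<odot> t \<odot> (\<one> - n) + (\<one> - n) \<odot> t \<odot> (\<one> - n)"
      using t by (simp add: mult_simps assoc nD)
  qed
  obtain a x b where s: "a \<in> upper_diag n" "x \<in> corner n" "b \<in> lower_diag n" "s = a + x + b"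
    using blocks [OF s] by blast
  obtain a' x' b' where t: "a' \<in> upper_diag n" "x' \<in> corner n" "b' \<in> lower_diag n" "t = a' + x' + b'"
    using blocks [OF t] by blast
  note [simp] = upper_diagD(1) [OF s(1)] cornerD(1) [OF s(2)] lower_diagD(1) [OF s(3)]
    upper_diagD(1) [OF t(1)] cornerD(1) [OF t(2)] lower_diagD(1) [OF t(3)]
  have z: "a \<odot> b' = 0" "x \<odot> a' = 0" "x \<odot> x' = 0" "b \<odot> a' = 0" "b \<odot> x' = 0"
    by (metis upper_diagD(3) [OF s(1)] lower_diagD(2) [OF t(3)] assoc mult_zero_right,
        metis cornerD(3) [OF s(2)] upper_diagD(2) [OF t(1)] assoc mult_zero_left,
        metis cornerD(3) [OF s(2)] cornerD(2) [OF t(2)] assoc mult_zero_left,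
        metis lower_diagD(3) [OF s(3)] upper_diagD(2) [OF t(1)] assoc mult_zero_left,
        metis lower_diagD(3) [OF s(3)] cornerD(2) [OF t(2)] assoc mult_zero_left)
  have "s \<odot> t = a \<odot> a' + a \<odot> x' + x \<odot> b' + b \<odot> b'"
    by (simp add: s t mult_simps z)
  hence "\<phi> (s \<odot> t) = \<phi> (a \<odot> a') + \<phi> (a \<odot> x') + \<phi> (x \<odot> b') + \<phi> (b \<odot> b')"
    by (simp add: add)
  also have "\<dots> = M (\<phi> s) (\<phi> t)"
    using s(1-3) t(1-3)
    by (simp add: s(4) t(4) add M_left M_right uu uc cl ll ul cu cc lu lc)
  finally show ?thesis .
qed

end

text \<open>The factor is unique because \<open>h\<close> is nonzero, and uniqueness makes the
  pointwise choice linear.\<close>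

lemma scalar_multiples_functional:
  fixes g :: "'v::complex_vector \<Rightarrow> 'v"
  assumes "h \<noteq> 0"
    and add: "\<And>x y. x \<in> S \<Longrightarrow> y \<in> S \<Longrightarrow> x + y \<in> S"
    and scale: "\<And>c x. x \<in> S \<Longrightarrow> c *\<^sub>C x \<in> S"
    and g: "clinear_on S g" "\<And>x. x \<in> S \<Longrightarrow> \<exists>s. g x = s *\<^sub>C h"
  shows "\<exists>\<kappa> :: 'v \<Rightarrow> complex. clinear_on S \<kappa> \<and> (\<forall>x\<in>S. g x = \<kappa> x *\<^sub>C h)"
proof -
  obtain \<kappa> where \<kappa>: "\<And>x. x \<in> S \<Longrightarrow> g x = \<kappa> x *\<^sub>C h"
    using g(2) by metis
  have inj: "s = t" if "s *\<^sub>C h = t *\<^sub>C h" for s t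
    using that assms(1) by (simp add: complex_vector.scale_cancel_right)
  have "clinear_on S \<kappa>"
    unfolding clinear_on_def
  proof (intro conjI ballI allI; rule inj)
    fix x y assume x: "x \<in> S" and y: "y \<in> S"
    have "\<kappa> (x + y) *\<^sub>C h = g x + g y"
      using g(1) x y add [OF x y] by (simp add: clinear_on_def flip: \<kappa>)
    thus "\<kappa> (x + y) *\<^sub>C h = (\<kappa> x + \<kappa> y) *\<^sub>C h"
      using x y by (simp add: \<kappa> scaleC_add_left)
  next
    fix c x assume x: "x \<in> S"
    have "\<kappa> (c *\<^sub>C x) *\<^sub>C h = c *\<^sub>C g x"
      using g(1) x scale [OF x] by (simp add: clinear_on_def flip: \<kappa>)
    thus "\<kappa> (c *\<^sub>C x) *\<^sub>C h = (c *\<^sub>C \<kappa> x) *\<^sub>C h"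
      using x by (simp add: \<kappa> scaleC_scaleC scaleC_complex_def)
  qed
  with \<kappa> show ?thesis by blast
qed

section \<open>Lie automorphisms, scalars and triangular idempotents\<close>

locale triangular_lie_automorphism = triangular_algebra +
  fixes \<theta> :: "'a \<Rightarrow> 'a"
  assumes lie_automorphism: "lie_automorphism mult S \<theta>"
begin

lemma \<theta>_mem [simp]: "x \<in> S \<Longrightarrow> \<theta> x \<in> S"
  using lie_automorphism by (auto simp: lie_automorphism_def bij_betw_def)

lemma \<theta>_add: "x \<in> S \<Longrightarrow> y \<in> S \<Longrightarrow> \<theta> (x + y) = \<theta> x + \<theta> y"
  using lie_automorphism by (auto simp: lie_automorphism_def clinear_on_def)

lemma \<theta>_scale: "x \<in> S \<Longrightarrow> \<theta> (c *\<^sub>C x) = c *\<^sub>C \<theta> x"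
  using lie_automorphism by (auto simp: lie_automorphism_def clinear_on_def)

lemma \<theta>_zero [simp]: "\<theta> 0 = 0"
  using \<theta>_scale [of 0 0] by simp

lemma \<theta>_minus: "x \<in> S \<Longrightarrow> \<theta> (- x) = - \<theta> x"
  using \<theta>_scale [of x "- 1"] by (simp add: scaleC_one)

lemma \<theta>_diff: "x \<in> S \<Longrightarrow> y \<in> S \<Longrightarrow> \<theta> (x - y) = \<theta> x - \<theta> y"
  using \<theta>_add [of x "- y"] by (simp add: \<theta>_minus)

lemma \<theta>_bracket: "x \<in> S \<Longrightarrow> y \<in> S \<Longrightarrow> \<theta> \<lbrakk>x, y\<rbrakk> = \<lbrakk>\<theta> x, \<theta> y\<rbrakk>"
  using lie_automorphism by (auto simp: lie_automorphism_def)

lemma \<theta>_cancel: "\<theta> x = \<theta> y \<Longrightarrow> x \<in> S \<Longrightarrow> y \<in> S \<Longrightarrow> x = y"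
  using lie_automorphism by (auto simp: lie_automorphism_def bij_betw_def inj_on_def)

lemma \<theta>_surj: "y \<in> S \<Longrightarrow> \<exists>x\<in>S. \<theta> x = y"
  using lie_automorphism unfolding lie_automorphism_def bij_betw_def by (metis imageE)

text \<open>Since \<open>\<theta>\<close> is onto, the image of a central element is
  central.\<close>

lemma \<theta>_scalar: "\<exists>t. \<theta> (s *\<^sub>C \<one>) = t *\<^sub>C \<one>"
proof (rule central_imp_scalar)
  fix y assume "y \<in> S"
  then obtain x where x: "x \<in> S" "\<theta> x = y" using \<theta>_surj by blast
  have "\<lbrakk>s *\<^sub>C \<one>, x\<rbrakk> = 0"
    using x by (simp add: bracket_eq mult_simps)
  thus "\<lbrakk>\<theta> (s *\<^sub>C \<one>), y\<rbrakk> = 0"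
    using \<theta>_bracket [of "s *\<^sub>C \<one>" x] x by simp
qed simp

lemma scalar_if_\<theta>_scalar:
  assumes x: "x \<in> S" and \<theta>x: "\<theta> x = s *\<^sub>C \<one>"
  shows "\<exists>t. x = t *\<^sub>C \<one>"
proof (rule central_imp_scalar [OF x])
  fix y assume y: "y \<in> S"
  have "\<theta> \<lbrakk>x, y\<rbrakk> = \<theta> 0"
    using x y by (simp add: \<theta>_bracket \<theta>x) (simp add: bracket_eq mult_simps)
  thus "\<lbrakk>x, y\<rbrakk> = 0"
    using x y \<theta>_cancel [of "\<lbrakk>x, y\<rbrakk>" 0] by simp
qed

text \<open>\<open>ad n\<close> is idempotent for triangular \<open>n\<close>, and
  \<open>\<theta>\<close> carries this identity over to \<open>ad (\<theta> n)\<close>.\<close>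

lemma \<theta>_tri_idem:
  assumes n: "tri_idem n"
  shows "\<exists>f c. tri_idem f \<and> \<theta> n = f + c *\<^sub>C \<one>"
proof (rule ad_idempotent_imp_tri_idem)
  note nD = tri_idemD [OF n]
  show "\<theta> n \<in> S" using nD(1) by simp
  show "\<theta> n \<noteq> c *\<^sub>C \<one>" for c
    using scalar_if_\<theta>_scalar [OF nD(1)] tri_idem_not_scalar [OF n] by blast
  fix y assume "y \<in> S"
  then obtain x where x: "x \<in> S" "\<theta> x = y" using \<theta>_surj by blast
  have nn: "n \<odot> (n \<odot> x) = n \<odot> x" by (metis nD(2) assoc)
  have "\<lbrakk>n, \<lbrakk>n, x\<rbrakk>\<rbrakk> = \<lbrakk>n, x\<rbrakk>"
    using x nD by (simp add: bracket_eq mult_simps assoc nn)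
  hence "\<theta> \<lbrakk>n, \<lbrakk>n, x\<rbrakk>\<rbrakk> = \<theta> \<lbrakk>n, x\<rbrakk>" by simp
  thus "\<lbrakk>\<theta> n, \<lbrakk>\<theta> n, y\<rbrakk>\<rbrakk> = \<lbrakk>\<theta> n, y\<rbrakk>"
    using x nD(1) by (simp add: \<theta>_bracket)
qed

text \<open>A zero of \<open>\<epsilon>\<close> has a scalar image under \<open>\<theta>\<close> and
  is therefore scalar; on scalars \<open>\<epsilon>\<close> multiplies by a nonzero factor. The same
  factor allows a preimage under \<open>\<theta>\<close> to be corrected along the unit.\<close>

lemma bij_betw_scalar_perturbation:
  assumes \<kappa>: "clinear_on S \<kappa>" and \<epsilon>: "\<And>x. x \<in> S \<Longrightarrow> \<epsilon> x = \<theta> x + \<kappa> x *\<^sub>C \<one>"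
    and \<epsilon>1: "\<epsilon> \<one> \<noteq> 0"
  shows "clinear_on S \<epsilon>" "bij_betw \<epsilon> S S"
proof -
  show lin: "clinear_on S \<epsilon>"
    using \<kappa> by (auto simp: clinear_on_def \<epsilon> \<theta>_add \<theta>_scale scaleC_add_left scaleC_add_right
        scaleC_scaleC scaleC_complex_def)
  hence sub: "\<epsilon> (x - y) = \<epsilon> x - \<epsilon> y" if "x \<in> S" "y \<in> S" for x y
    using that add_mem [of "x - y" y] diff_mem [of x y] unfolding clinear_on_def
    by (metis add_diff_cancel diff_add_cancel)
  have sc: "\<epsilon> (s *\<^sub>C \<one>) = s *\<^sub>C \<epsilon> \<one>" for s
    using lin by (simp add: clinear_on_def)
  obtain w where "\<theta> (1 *\<^sub>C \<one>) = w *\<^sub>C \<one>"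
    using \<theta>_scalar by blast
  hence w: "\<epsilon> \<one> = (w + \<kappa> \<one>) *\<^sub>C \<one>"
    by (simp add: \<epsilon> scaleC_one scaleC_add_left)
  hence w0: "w + \<kappa> \<one> \<noteq> 0"
    using \<epsilon>1 by auto
  have "inj_on \<epsilon> S"
  proof (rule inj_onI)
    fix x y assume x: "x \<in> S" and y: "y \<in> S" and "\<epsilon> x = \<epsilon> y"
    hence 0: "\<epsilon> (x - y) = 0" by (simp add: sub)
    hence "\<theta> (x - y) = (- \<kappa> (x - y)) *\<^sub>C \<one>"
      using x y by (simp add: \<epsilon> eq_neg_iff_add_eq_0)
    then obtain t where t: "x - y = t *\<^sub>C \<one>"
      using scalar_if_\<theta>_scalar diff_mem x y by blast
    with 0 sc have "t *\<^sub>C \<epsilon> \<one> = 0" by simp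
    with \<epsilon>1 t show "x = y" by (simp add: complex_vector.scale_eq_0_iff)
  qed
  moreover have "\<epsilon> ` S = S"
  proof
    show "\<epsilon> ` S \<subseteq> S" by (auto simp: \<epsilon>)
    show "S \<subseteq> \<epsilon> ` S"
    proof
      fix y assume "y \<in> S"
      then obtain x where x: "x \<in> S" "\<theta> x = y" using \<theta>_surj by blast
      have "\<epsilon> (x - (\<kappa> x / (w + \<kappa> \<one>)) *\<^sub>C \<one>) = \<epsilon> x - \<kappa> x *\<^sub>C \<one>"
        using x w0 by (simp add: sub sc w scaleC_scaleC)
      also have "\<dots> = y"
        using x by (simp add: \<epsilon>)
      finally have "\<epsilon> (x - (\<kappa> x / (w + \<kappa> \<one>)) *\<^sub>C \<one>) = y" .
      with x show "y \<in> \<epsilon> ` S" by (metis diff_mem scale_mem unit_mem imageI)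
    qed
  qed
  ultimately show "bij_betw \<epsilon> S S" by (simp add: bij_betw_def)
qed

end

section \<open>Scalar blocks in the images of the diagonals\<close>

locale triangular_lie_blocks = triangular_lie_automorphism +
  fixes n f :: 'a and c :: complex
  assumes n: "tri_idem n" and f: "tri_idem f" and \<theta>n: "\<theta> n = f + c *\<^sub>C \<one>"
begin

lemmas nD = tri_idemD [OF n] and fD = tri_idemD [OF f]

declare nD(1) [simp] fD(1) [simp]

lemma bracket_f_\<theta>: "x \<in> S \<Longrightarrow> \<lbrakk>f, \<theta> x\<rbrakk> = \<theta> \<lbrakk>n, x\<rbrakk>"
  by (simp add: \<theta>_bracket \<theta>n bracket_shift)

lemma \<theta>_corner: "x \<in> corner n \<Longrightarrow> \<theta> x \<in> corner f"
  by (simp add: corner_iff_bracket [OF n] corner_iff_bracket [OF f] bracket_f_\<theta>)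

lemma \<theta>_corner_surj:
  assumes "y \<in> corner f"
  shows "\<exists>x\<in>corner n. \<theta> x = y"
proof -
  obtain x where x: "x \<in> S" "\<theta> x = y"
    using \<theta>_surj cornerD(1) [OF assms] by blast
  have "\<theta> \<lbrakk>n, x\<rbrakk> = \<theta> x"
    using assms x by (simp add: corner_iff_bracket [OF f] flip: bracket_f_\<theta>)
  thus ?thesis
    using x \<theta>_cancel [of "\<lbrakk>n, x\<rbrakk>" x] by (auto simp: corner_iff_bracket [OF n])
qed

lemma \<theta>_commutes_iff: "d \<in> S \<Longrightarrow> f \<odot> \<theta> d = \<theta> d \<odot> f \<longleftrightarrow> n \<odot> d = d \<odot> n"
  using bracket_f_\<theta> [of d] \<theta>_cancel [of "\<lbrakk>n, d\<rbrakk>" 0] by (auto simp: bracket_eq)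

text \<open>Named after its effect: \<open>\<theta> d\<close> then acts on \<open>corner f\<close>
  from the left as a scalar.\<close>

definition left_scalar :: "'a \<Rightarrow> bool" where
  "left_scalar d \<longleftrightarrow> (\<exists>s. \<theta> d \<odot> f = s *\<^sub>C f)"

definition right_scalar :: "'a \<Rightarrow> bool" where
  "right_scalar d \<longleftrightarrow> (\<exists>s. (\<one> - f) \<odot> \<theta> d = s *\<^sub>C (\<one> - f))"

text \<open>Transported to \<open>corner f\<close>, the hypothesis becomes a bilinear relation whose
  middle term is \<open>- 2 D y D\<close> with \<open>D = \<theta> d\<close>;
  \<open>corner_bilinear\<close> then makes \<open>D\<close> scalar on one of the two sides.\<close>

lemma left_or_right_scalar:
  assumes d: "d \<in> S" and w: "w \<in> S"
    and ad: "\<And>x. x \<in> corner n \<Longrightarrow> \<lbrakk>d, \<lbrakk>d, x\<rbrakk>\<rbrakk> = \<lbrakk>w, x\<rbrakk>"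
  shows "left_scalar d \<or> right_scalar d"
proof -
  let ?D = "\<theta> d"
  have D: "(?D \<odot> ?D - \<theta> w) \<odot> y + (- (?D + ?D)) \<odot> y \<odot> ?D + y \<odot> (?D \<odot> ?D + \<theta> w) = 0"
    if y: "y \<in> corner f" for y
  proof -
    obtain x where x: "x \<in> corner n" "\<theta> x = y"
      using \<theta>_corner_surj y by blast
    note [simp] = cornerD(1) [OF x(1)] d w
    have "\<theta> \<lbrakk>d, \<lbrakk>d, x\<rbrakk>\<rbrakk> = \<theta> \<lbrakk>w, x\<rbrakk>"
      using ad [OF x(1)] by simp
    thus ?thesis
      by (simp add: \<theta>_bracket x(2)) (simp add: bracket_eq mult_simps assoc algebra_simps)
  qed
  have "(\<exists>s. (- (?D + ?D)) \<odot> f = s *\<^sub>C f) \<or> right_scalar d"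
    using corner_bilinear [OF f _ _ _ _ D] d w by (auto simp: right_scalar_def)
  moreover have "left_scalar d" if "(- (?D + ?D)) \<odot> f = s *\<^sub>C f" for s
  proof -
    have "- (?D \<odot> f + ?D \<odot> f) = s *\<^sub>C f"
      using that d by (simp add: mult_simps)
    hence "?D \<odot> f + ?D \<odot> f = - (s *\<^sub>C f)"
      by (metis minus_minus)
    hence "(1/2) *\<^sub>C (2 *\<^sub>C (?D \<odot> f)) = (1/2) *\<^sub>C (- s) *\<^sub>C f"
      using complex_vector.scale_left_distrib [of 1 1 "?D \<odot> f"] by simp
    thus ?thesis
      unfolding left_scalar_def by (intro exI [of _ "- s / 2"]) simp
  qed
  ultimately show ?thesis by blast
qed

lemma left_scalar_diff: "left_scalar x \<Longrightarrow> left_scalar y \<Longrightarrow> x \<in> S \<Longrightarrow> y \<in> S \<Longrightarrow> left_scalar (x - y)"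
  unfolding left_scalar_def by (metis \<theta>_diff diff_left complex_vector.scale_left_diff_distrib)

lemma right_scalar_diff:
  "right_scalar x \<Longrightarrow> right_scalar y \<Longrightarrow> x \<in> S \<Longrightarrow> y \<in> S \<Longrightarrow> right_scalar (x - y)"
  unfolding right_scalar_def by (metis \<theta>_diff diff_right complex_vector.scale_left_diff_distrib)

text \<open>The argument that a group is not the union of two proper subgroups: if \<open>x\<close>
  fails one property and \<open>y\<close> the other, then \<open>x + y\<close> fails both.\<close>

lemma all_left_or_all_right_scalar:
  assumes V: "V \<subseteq> S" "\<And>x y. x \<in> V \<Longrightarrow> y \<in> V \<Longrightarrow> x + y \<in> V"
    and scalar: "\<And>x. x \<in> V \<Longrightarrow> left_scalar x \<or> right_scalar x"
  shows "(\<forall>x\<in>V. left_scalar x) \<or> (\<forall>x\<in>V. right_scalar x)"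
proof (rule ccontr)
  assume "\<not> ?thesis"
  then obtain x y where x: "x \<in> V" "\<not> left_scalar x" and y: "y \<in> V" "\<not> right_scalar y" by blast
  have rx: "right_scalar x" and ly: "left_scalar y" using scalar x y by blast+
  have "\<not> left_scalar (x + y)"
    using left_scalar_diff [of "x + y" y] ly x y V by auto
  moreover have "\<not> right_scalar (x + y)"
    using right_scalar_diff [of "x + y" x] rx x y V by auto
  ultimately show False using scalar V x y by blast
qed

lemma upper_diag_scalar:
  "(\<forall>a\<in>upper_diag n. left_scalar a) \<or> (\<forall>a\<in>upper_diag n. right_scalar a)"
proof (rule all_left_or_all_right_scalar)
  fix a assume a: "a \<in> upper_diag n"
  note aD = upper_diagD [OF a]
  show "left_scalar a \<or> right_scalar a"
  \<comment> \<open>Because \<open>x a = 0\<close>, the double bracket is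
    \<open>a^2 x\<close>.\<close>
  proof (rule left_or_right_scalar [of a "a \<odot> a"])
    fix x assume x: "x \<in> corner n"
    note xD = cornerD [OF x]
    have xa: "x \<odot> a = 0" by (metis aD(2) xD(3) assoc mult_zero_left)
    have xay: "x \<odot> (a \<odot> y) = 0" for y by (metis xa assoc mult_zero_left)
    show "\<lbrakk>a, \<lbrakk>a, x\<rbrakk>\<rbrakk> = \<lbrakk>a \<odot> a, x\<rbrakk>"
      by (simp add: bracket_eq mult_simps assoc xa xay)
  qed (use aD in simp_all)
qed (auto simp: upper_diag_def mult_simps)

lemma lower_diag_scalar:
  "(\<forall>b\<in>lower_diag n. left_scalar b) \<or> (\<forall>b\<in>lower_diag n. right_scalar b)"
proof (rule all_left_or_all_right_scalar)
  fix b assume b: "b \<in> lower_diag n"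
  note bD = lower_diagD [OF b]
  show "left_scalar b \<or> right_scalar b"
  \<comment> \<open>Because \<open>b x = 0\<close>, the double bracket is \<open>x b^2\<close>; the
    minus sign turns this right multiplication into a bracket.\<close>
  proof (rule left_or_right_scalar [of b "- (b \<odot> b)"])
    fix x assume x: "x \<in> corner n"
    note xD = cornerD [OF x]
    have bx: "b \<odot> x = 0" by (metis bD(3) xD(2) assoc mult_zero_left)
    have bxy: "b \<odot> (x \<odot> y) = 0" for y by (metis bx assoc mult_zero_left)
    show "\<lbrakk>b, \<lbrakk>b, x\<rbrakk>\<rbrakk> = \<lbrakk>- (b \<odot> b), x\<rbrakk>"
      by (simp add: bracket_eq mult_simps assoc bx bxy)
  qed (use bD in simp_all)
qed (auto simp: lower_diag_def mult_simps)


text \<open>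
  If the image of every product \<open>x \<mapsto> a x b\<close> is again a commutator with a block-diagonal \<open>r\<close>,
  pulling \<open>r\<close> back gives \<open>a x b = [x, d]\<close> on the corner, so \<open>a\<close> or \<open>b\<close> is scalar.
\<close>

lemma diag_block_scalar_if_mixed:
  assumes mixed: "\<And>a b y. a \<in> upper_diag n \<Longrightarrow> b \<in> lower_diag n \<Longrightarrow>
    \<exists>r\<in>S. f \<odot> r = r \<odot> f \<and> (\<forall>y\<in>corner f. \<lbrakk>\<theta> b, \<lbrakk>\<theta> a, y\<rbrakk>\<rbrakk> = \<lbrakk>r, y\<rbrakk>)"
  shows "(\<forall>a\<in>upper_diag n. left_scalar a \<and> right_scalar a) \<or>
    (\<forall>b\<in>lower_diag n. left_scalar b \<and> right_scalar b)"
proof -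
  have ab: "(\<exists>s. a \<odot> n = s *\<^sub>C n) \<or> (\<exists>s. (\<one> - n) \<odot> b = s *\<^sub>C (\<one> - n))"
    if a: "a \<in> upper_diag n" and b: "b \<in> lower_diag n" for a b
  proof -
    note aD = upper_diagD [OF a] and bD = lower_diagD [OF b]
    obtain r where r: "r \<in> S" "f \<odot> r = r \<odot> f" "\<And>y. y \<in> corner f \<Longrightarrow> \<lbrakk>\<theta> b, \<lbrakk>\<theta> a, y\<rbrakk>\<rbrakk> = \<lbrakk>r, y\<rbrakk>"
      using mixed [OF a b] by blast
    obtain d where d: "d \<in> S" "\<theta> d = r" using \<theta>_surj r(1) by blast
    have "d \<odot> x + a \<odot> x \<odot> b + x \<odot> (- d) = 0" if x: "x \<in> corner n" for x
    proof -
      note xD = cornerD [OF x]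
      have "\<theta> \<lbrakk>b, \<lbrakk>a, x\<rbrakk>\<rbrakk> = \<theta> \<lbrakk>d, x\<rbrakk>"
        using r(3) [OF \<theta>_corner [OF x]] aD(1) bD(1) xD(1) d by (simp add: \<theta>_bracket)
      hence "\<lbrakk>b, \<lbrakk>a, x\<rbrakk>\<rbrakk> = \<lbrakk>d, x\<rbrakk>"
        by (rule \<theta>_cancel) (use aD(1) bD(1) xD(1) d in simp_all)
      moreover have "x \<odot> a = 0" by (metis aD(2) xD(3) assoc mult_zero_left)
      moreover have "b \<odot> (a \<odot> x) = 0" by (metis aD(2) bD(3) assoc mult_zero_left)
      ultimately show ?thesis
        by (simp add: bracket_eq mult_simps assoc algebra_simps)
    qed
    from corner_bilinear [OF n _ _ _ _ this] show ?thesis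
      using aD(1) bD(1) d by simp
  qed
  \<comment> \<open>\<open>\<theta>\<close> maps combinations of \<open>n\<close> and
    \<open>\<one>\<close> to combinations of \<open>f\<close> and \<open>\<one>\<close>, which are
    scalar on both blocks. Multiples of \<open>n\<close> and of \<open>\<one> - n\<close> are of
    this form.\<close>
  have both: "left_scalar d \<and> right_scalar d" if "d = s *\<^sub>C n + t *\<^sub>C \<one>" for s t d
  proof -
    obtain w where w: "\<theta> (t *\<^sub>C \<one>) = w *\<^sub>C \<one>" using \<theta>_scalar by blast
    have "\<theta> d = s *\<^sub>C f + (s * c + w) *\<^sub>C \<one>"
      by (simp add: that \<theta>_add \<theta>_scale \<theta>n w scaleC_add_right scaleC_add_left scaleC_scaleC)
    hence "\<theta> d \<odot> f = (s + s * c + w) *\<^sub>C f \<and> (\<one> - f) \<odot> \<theta> d = (s * c + w) *\<^sub>C (\<one> - f)"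
      by (simp add: mult_simps fD scaleC_add_left complex_vector.scale_right_diff_distrib algebra_simps)
    thus ?thesis by (auto simp: left_scalar_def right_scalar_def)
  qed
  show ?thesis
  proof (cases "\<forall>a\<in>upper_diag n. \<exists>s. a \<odot> n = s *\<^sub>C n")
    case True
    hence "\<forall>a\<in>upper_diag n. \<exists>s. a = s *\<^sub>C n + 0 *\<^sub>C \<one>"
      by (simp add: upper_diagD)
    thus ?thesis using both by blast
  next
    case False
    hence "\<forall>b\<in>lower_diag n. \<exists>s. (\<one> - n) \<odot> b = s *\<^sub>C (\<one> - n)"
      using ab by blast
    hence "\<forall>b\<in>lower_diag n. \<exists>s. b = (- s) *\<^sub>C n + s *\<^sub>C \<one>"
      by (simp add: lower_diagD mult_simps complex_vector.scale_right_diff_distrib)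
    thus ?thesis using both by blast
  qed
qed

text \<open>Two of the four combinations are the claim. In the other two the double bracket with
  \<open>\<theta> a\<close> and \<open>\<theta> b\<close> is a one-sided multiplication, so
  \<open>diag_block_scalar_if_mixed\<close> makes one diagonal scalar on both sides, which leads
  back to the claim.\<close>

lemma diag_scalar_cases:
  "(\<forall>a\<in>upper_diag n. right_scalar a) \<and> (\<forall>b\<in>lower_diag n. left_scalar b) \<or>
   (\<forall>a\<in>upper_diag n. left_scalar a) \<and> (\<forall>b\<in>lower_diag n. right_scalar b)"
proof -
  consider "(\<forall>a\<in>upper_diag n. right_scalar a)" "(\<forall>b\<in>lower_diag n. left_scalar b)"
    | "(\<forall>a\<in>upper_diag n. left_scalar a)" "(\<forall>b\<in>lower_diag n. right_scalar b)"
    | "(\<forall>a\<in>upper_diag n. left_scalar a)" "(\<forall>b\<in>lower_diag n. left_scalar b)"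
    | "(\<forall>a\<in>upper_diag n. right_scalar a)" "(\<forall>b\<in>lower_diag n. right_scalar b)"
    using upper_diag_scalar lower_diag_scalar by blast
  thus ?thesis
  proof cases
    case 3
    have "(\<forall>a\<in>upper_diag n. left_scalar a \<and> right_scalar a) \<or>
      (\<forall>b\<in>lower_diag n. left_scalar b \<and> right_scalar b)"
    proof (rule diag_block_scalar_if_mixed)
      fix a b assume a: "a \<in> upper_diag n" and b: "b \<in> lower_diag n"
      note [simp] = upper_diagD(1) [OF a] lower_diagD(1) [OF b]
      obtain s t where s: "\<theta> a \<odot> f = s *\<^sub>C f" and t: "\<theta> b \<odot> f = t *\<^sub>C f"
        using 3 a b by (metis left_scalar_def)
      have comm: "f \<odot> \<theta> a = \<theta> a \<odot> f" "f \<odot> \<theta> b = \<theta> b \<odot> f"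
        using \<theta>_commutes_iff upper_diagD [OF a] lower_diagD [OF b] by simp_all
      \<comment> \<open>Both images act from the left as scalars, so the double bracket is
        \<open>y (\<theta> a - s) (\<theta> b - t)\<close>. The sign is needed because
        \<open>r y = 0\<close> and hence \<open>[r, y] = - y r\<close>.\<close>
      define r where "r = - ((\<theta> a - s *\<^sub>C \<one>) \<odot> (\<theta> b - t *\<^sub>C \<one>))"
      have r: "r \<in> S" by (simp add: r_def)
      have rf: "r \<odot> f = 0"
        by (simp add: r_def mult_simps assoc t)
      have fr: "f \<odot> r = 0"
      proof -
        have "f \<odot> (\<theta> a - s *\<^sub>C \<one>) = 0"
          by (simp add: mult_simps comm s)
        thus ?thesis
          by (metis assoc minus_right mult_zero_left neg_0_equal_iff_equal r_def)
      qed
      have "\<lbrakk>\<theta> b, \<lbrakk>\<theta> a, y\<rbrakk>\<rbrakk> = \<lbrakk>r, y\<rbrakk>" if y: "y \<in> corner f" for y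
      proof -
        note yD = cornerD [OF y]
        note [simp] = yD(1)
        have ay: "\<theta> a \<odot> y = s *\<^sub>C y" by (metis s yD(1,2) assoc scale_left fD(1))
        have by': "\<theta> b \<odot> (y \<odot> x) = t *\<^sub>C (y \<odot> x)" if "x \<in> S" for x
          by (metis t yD(1,2) assoc scale_left fD(1) that mult_mem)
        have by0: "\<theta> b \<odot> y = t *\<^sub>C y"
          by (metis t yD(1,2) assoc scale_left fD(1))
        have ry: "r \<odot> y = 0" by (metis rf yD(2) assoc mult_zero_left)
        show ?thesis
          by (simp add: bracket_eq ry) (simp add: r_def mult_simps assoc ay by' by0
              complex_vector.scale_right_diff_distrib mult.commute)
      qed
      with r rf fr show "\<exists>r\<in>S. f \<odot> r = r \<odot> f \<and> (\<forall>y\<in>corner f. \<lbrakk>\<theta> b, \<lbrakk>\<theta> a, y\<rbrakk>\<rbrakk> = \<lbrakk>r, y\<rbrakk>)"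
        by (intro bexI [of _ r]) auto
    qed
    with 3 show ?thesis by blast
  next
    case 4
    have "(\<forall>a\<in>upper_diag n. left_scalar a \<and> right_scalar a) \<or>
      (\<forall>b\<in>lower_diag n. left_scalar b \<and> right_scalar b)"
    proof (rule diag_block_scalar_if_mixed)
      fix a b assume a: "a \<in> upper_diag n" and b: "b \<in> lower_diag n"
      note [simp] = upper_diagD(1) [OF a] lower_diagD(1) [OF b]
      obtain s t where s: "(\<one> - f) \<odot> \<theta> a = s *\<^sub>C (\<one> - f)" and t: "(\<one> - f) \<odot> \<theta> b = t *\<^sub>C (\<one> - f)"
        using 4 a b by (metis right_scalar_def)
      have comm: "f \<odot> \<theta> a = \<theta> a \<odot> f" "f \<odot> \<theta> b = \<theta> b \<odot> f"
        using \<theta>_commutes_iff upper_diagD [OF a] lower_diagD [OF b] by simp_all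
      \<comment> \<open>Now the right actions are scalar: the double bracket is
        \<open>(\<theta> b - t) (\<theta> a - s) y\<close>, and \<open>y r = 0\<close>.\<close>
      define r where "r = (\<theta> b - t *\<^sub>C \<one>) \<odot> (\<theta> a - s *\<^sub>C \<one>)"
      have r: "r \<in> S" by (simp add: r_def)
      have bf: "f \<odot> (\<theta> b - t *\<^sub>C \<one>) = \<theta> b - t *\<^sub>C \<one>" "(\<theta> a - s *\<^sub>C \<one>) \<odot> f = \<theta> a - s *\<^sub>C \<one>"
        using s t by (simp_all add: mult_simps comm complex_vector.scale_right_diff_distrib algebra_simps)
      have rf: "r \<odot> f = r" "f \<odot> r = r"
        by (simp add: r_def assoc bf, metis r_def assoc bf(1))
      have "\<lbrakk>\<theta> b, \<lbrakk>\<theta> a, y\<rbrakk>\<rbrakk> = \<lbrakk>r, y\<rbrakk>" if y: "y \<in> corner f" for y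
      proof -
        note yD = cornerD [OF y]
        note [simp] = yD(1)
        have y': "y \<odot> (\<one> - f) = y" by (simp add: mult_simps yD)
        have ay: "y \<odot> \<theta> a = s *\<^sub>C y"
          by (metis s y' assoc scale_right yD(1) diff_mem unit_mem fD(1))
        have by0: "y \<odot> \<theta> b = t *\<^sub>C y"
          by (metis t y' assoc scale_right yD(1) diff_mem unit_mem fD(1))
        have yr: "y \<odot> r = 0" by (metis rf(2) yD(3) assoc mult_zero_left)
        show ?thesis
          by (simp add: bracket_eq yr) (simp add: r_def mult_simps assoc ay by0
              complex_vector.scale_right_diff_distrib mult.commute)
      qed
      with r rf show "\<exists>r\<in>S. f \<odot> r = r \<odot> f \<and> (\<forall>y\<in>corner f. \<lbrakk>\<theta> b, \<lbrakk>\<theta> a, y\<rbrakk>\<rbrakk> = \<lbrakk>r, y\<rbrakk>)"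
        by (intro bexI [of _ r]) auto
    qed
    with 4 show ?thesis by blast
  qed auto
qed

end

section \<open>Removing the scalars and recovering multiplicativity\<close>

context triangular_lie_blocks
begin

text \<open>Applied with \<open>h\<close> and \<open>k\<close> equal to \<open>f\<close> and
  \<open>\<one> - f\<close> in either order. Each scalar is read off after compression to one
  diagonal block of \<open>n\<close>, so the two functionals do not disturb each other and both
  vanish on the corner.\<close>

lemma scalar_correction:
  assumes h: "h \<in> S" "h \<noteq> 0" and k: "k \<in> S" "k \<noteq> 0"
    and upper: "\<And>a. a \<in> upper_diag n \<Longrightarrow> \<exists>s. h \<odot> \<theta> a = s *\<^sub>C h"
    and lower: "\<And>b. b \<in> lower_diag n \<Longrightarrow> \<exists>s. k \<odot> \<theta> b = s *\<^sub>C k"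
  shows "\<exists>\<kappa>. clinear_on S \<kappa> \<and> (\<forall>x\<in>corner n. \<kappa> x = 0) \<and>
    (\<forall>a\<in>upper_diag n. h \<odot> (\<theta> a + \<kappa> a *\<^sub>C \<one>) = 0) \<and>
    (\<forall>b\<in>lower_diag n. k \<odot> (\<theta> b + \<kappa> b *\<^sub>C \<one>) = 0)"
proof -
  let ?p = "\<lambda>t. n \<odot> t \<odot> n" and ?q = "\<lambda>t. (\<one> - n) \<odot> t \<odot> (\<one> - n)"
  have nn: "n \<odot> (n \<odot> x) = n \<odot> x" for x
    by (metis nD(2) assoc)
  have p: "?p t \<in> upper_diag n" and q: "?q t \<in> lower_diag n" if "t \<in> S" for t
    using that by (simp_all add: upper_diag_def lower_diag_def mult_simps assoc nD nn)
  have "\<exists>\<kappa>. clinear_on S \<kappa> \<and> (\<forall>x\<in>S. h \<odot> \<theta> (?p x) = \<kappa> x *\<^sub>C h)"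
    by (rule scalar_multiples_functional)
      (use h p upper in \<open>auto simp: clinear_on_def mult_simps \<theta>_add \<theta>_scale\<close>)
  then obtain \<kappa>1 where \<kappa>1: "clinear_on S \<kappa>1" "\<And>x. x \<in> S \<Longrightarrow> h \<odot> \<theta> (?p x) = \<kappa>1 x *\<^sub>C h"
    by blast
  have "\<exists>\<kappa>. clinear_on S \<kappa> \<and> (\<forall>x\<in>S. k \<odot> \<theta> (?q x) = \<kappa> x *\<^sub>C k)"
  proof (rule scalar_multiples_functional)
    show "clinear_on S (\<lambda>x. k \<odot> \<theta> (?q x))"
      using k by (simp add: clinear_on_def mult_simps \<theta>_add \<theta>_scale \<theta>_diff
          scaleC_add_right complex_vector.scale_right_diff_distrib)
  qed (use k q lower in auto)
  then obtain \<kappa>2 where \<kappa>2: "clinear_on S \<kappa>2" "\<And>x. x \<in> S \<Longrightarrow> k \<odot> \<theta> (?q x) = \<kappa>2 x *\<^sub>C k"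
    by blast
  have \<kappa>1_0: "\<kappa>1 x = 0" if "x \<in> S" "?p x = 0" for x
    using \<kappa>1(2) [OF that(1)] that(2) h by (simp add: complex_vector.scale_eq_0_iff)
  have \<kappa>2_0: "\<kappa>2 x = 0" if "x \<in> S" "?q x = 0" for x
    using \<kappa>2(2) [OF that(1)] that(2) k by (simp add: complex_vector.scale_eq_0_iff)
  let ?\<kappa> = "\<lambda>x. - (\<kappa>1 x + \<kappa>2 x)"
  have "clinear_on S ?\<kappa>"
    using \<kappa>1(1) \<kappa>2(1) by (simp add: clinear_on_def scaleC_complex_def algebra_simps)
  moreover have "?\<kappa> x = 0" if "x \<in> corner n" for x
    using cornerD [OF that] by (simp add: \<kappa>1_0 \<kappa>2_0 mult_simps)
  moreover have "h \<odot> (\<theta> a + ?\<kappa> a *\<^sub>C \<one>) = 0" if a: "a \<in> upper_diag n" for a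
    using upper_diagD [OF a] \<kappa>1(2) [of a] \<kappa>2_0 [of a] h by (simp add: mult_simps)
  moreover have "k \<odot> (\<theta> b + ?\<kappa> b *\<^sub>C \<one>) = 0" if b: "b \<in> lower_diag n" for b
    using lower_diagD [OF b] \<kappa>2(2) [of b] \<kappa>1_0 [of b] k by (simp add: mult_simps)
  ultimately show ?thesis by blast
qed

end

locale triangular_lie_correction = triangular_lie_blocks +
  fixes \<kappa> :: "'a \<Rightarrow> complex" and \<epsilon> :: "'a \<Rightarrow> 'a"
  assumes \<kappa>_linear: "clinear_on S \<kappa>" and \<kappa>_corner: "x \<in> corner n \<Longrightarrow> \<kappa> x = 0"
    and \<epsilon>_def: "\<epsilon> x = \<theta> x + \<kappa> x *\<^sub>C \<one>"
begin

lemma \<epsilon>_mem [simp]: "x \<in> S \<Longrightarrow> \<epsilon> x \<in> S"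
  by (simp add: \<epsilon>_def)

lemma \<epsilon>_add: "x \<in> S \<Longrightarrow> y \<in> S \<Longrightarrow> \<epsilon> (x + y) = \<epsilon> x + \<epsilon> y"
  using \<kappa>_linear by (simp add: \<epsilon>_def clinear_on_def \<theta>_add scaleC_add_left)

lemma \<epsilon>_corner: "x \<in> corner n \<Longrightarrow> \<epsilon> x \<in> corner f"
  by (simp add: \<epsilon>_def \<kappa>_corner \<theta>_corner)

lemma \<epsilon>_corner_surj: "y \<in> corner f \<Longrightarrow> \<exists>x\<in>corner n. \<epsilon> x = y"
  using \<theta>_corner_surj by (auto simp: \<epsilon>_def \<kappa>_corner)

lemma \<epsilon>_commutes: "d \<in> S \<Longrightarrow> n \<odot> d = d \<odot> n \<Longrightarrow> f \<odot> \<epsilon> d = \<epsilon> d \<odot> f"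
  using \<theta>_commutes_iff [of d] by (simp add: \<epsilon>_def mult_simps)

text \<open>Scalars drop out of the bracket on the right, and \<open>\<kappa>\<close> vanishes on
  its value on the left.\<close>

lemma \<epsilon>_bracket_corner:
  "d \<in> S \<Longrightarrow> x \<in> corner n \<Longrightarrow> \<lbrakk>d, x\<rbrakk> \<in> corner n \<Longrightarrow> \<epsilon> \<lbrakk>d, x\<rbrakk> = \<lbrakk>\<epsilon> d, \<epsilon> x\<rbrakk>"
  using cornerD(1) [of x n] by (simp add: \<epsilon>_def \<kappa>_corner \<theta>_bracket bracket_shift)

text \<open>The product \<open>a x\<close> is the bracket of \<open>a\<close> and \<open>x\<close>,
  since \<open>x a = 0\<close>.\<close>

lemma upper_corner:
  assumes a: "a \<in> upper_diag n" and x: "x \<in> corner n"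
  shows "a \<odot> x \<in> corner n" "\<epsilon> (a \<odot> x) = \<lbrakk>\<epsilon> a, \<epsilon> x\<rbrakk>"
proof -
  note aD = upper_diagD [OF a] and xD = cornerD [OF x]
  have "n \<odot> (a \<odot> x) = a \<odot> x" by (metis aD(2) assoc)
  thus ax: "a \<odot> x \<in> corner n"
    using aD xD by (simp add: corner_def assoc)
  have "x \<odot> a = 0" by (metis aD(2) xD(3) assoc mult_zero_left)
  hence "a \<odot> x = \<lbrakk>a, x\<rbrakk>" by (simp add: bracket_eq)
  thus "\<epsilon> (a \<odot> x) = \<lbrakk>\<epsilon> a, \<epsilon> x\<rbrakk>"
    using \<epsilon>_bracket_corner [OF aD(1) x] ax by simp
qed

lemma corner_lower:
  assumes b: "b \<in> lower_diag n" and x: "x \<in> corner n"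
  shows "x \<odot> b \<in> corner n" "\<epsilon> (x \<odot> b) = \<lbrakk>\<epsilon> x, \<epsilon> b\<rbrakk>"
proof -
  note bD = lower_diagD [OF b] and xD = cornerD [OF x]
  have "n \<odot> (x \<odot> b) = x \<odot> b" by (metis xD(2) assoc)
  thus xb: "x \<odot> b \<in> corner n"
    using bD xD by (simp add: corner_def assoc)
  have "b \<odot> x = 0" by (metis xD(2) bD(3) assoc mult_zero_left)
  \<comment> \<open>\<open>\<epsilon>_bracket_corner\<close> takes the diagonal element first, hence
    the detour through the negative.\<close>
  hence "\<lbrakk>b, x\<rbrakk> = - (x \<odot> b)" "\<lbrakk>b, x\<rbrakk> \<in> corner n"
    using xb by (simp_all add: bracket_eq corner_def mult_simps)
  hence "\<epsilon> (- (x \<odot> b)) = \<lbrakk>\<epsilon> b, \<epsilon> x\<rbrakk>"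
    using \<epsilon>_bracket_corner [OF bD(1) x] by simp
  moreover have "\<epsilon> (- (x \<odot> b)) = - \<epsilon> (x \<odot> b)"
    using \<epsilon>_add [of "x \<odot> b" "- (x \<odot> b)"] \<epsilon>_add [of 0 0] bD(1) xD(1)
    by (simp add: eq_neg_iff_add_eq_0 add.commute)
  ultimately show "\<epsilon> (x \<odot> b) = \<lbrakk>\<epsilon> x, \<epsilon> b\<rbrakk>"
    by (simp add: bracket_eq minus_equation_iff [of "\<epsilon> (x \<odot> b)"])
qed

lemma upper_upper: "a \<in> upper_diag n \<Longrightarrow> a' \<in> upper_diag n \<Longrightarrow> a \<odot> a' \<in> upper_diag n"
  unfolding upper_diag_def by (simp add: assoc) (metis assoc)

lemma lower_lower: "b \<in> lower_diag n \<Longrightarrow> b' \<in> lower_diag n \<Longrightarrow> b \<odot> b' \<in> lower_diag n"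
  unfolding lower_diag_def by (simp add: assoc) (metis assoc mult_zero_left)

text \<open>Here \<open>\<epsilon>\<close> keeps every block in its place. Products with corner
  elements are brackets and so are respected; for a diagonal, \<open>(a a') x = a (a' x)\<close> and
  \<open>x (b b') = (x b) b'\<close> give equality after acting on the corner, and the corner is
  faithful.\<close>

lemma automorphism:
  assumes upper: "\<And>a. a \<in> upper_diag n \<Longrightarrow> (\<one> - f) \<odot> \<epsilon> a = 0"
    and lower: "\<And>b. b \<in> lower_diag n \<Longrightarrow> f \<odot> \<epsilon> b = 0"
  shows "alg_automorphism mult S \<epsilon>"
proof -
  have u: "f \<odot> \<epsilon> a = \<epsilon> a" "\<epsilon> a \<odot> f = \<epsilon> a" if "a \<in> upper_diag n" for a
    using upper [OF that] upper_diagD [OF that] \<epsilon>_commutes [of a] by (simp_all add: mult_simps)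
  have l: "f \<odot> \<epsilon> b = 0" "\<epsilon> b \<odot> f = 0" if "b \<in> lower_diag n" for b
    using lower [OF that] lower_diagD [OF that] \<epsilon>_commutes [of b] by simp_all
  note c = cornerD [OF \<epsilon>_corner]
  have cu: "\<epsilon> x \<odot> \<epsilon> a = 0" if "x \<in> corner n" "a \<in> upper_diag n" for x a
    by (metis c(3) u(1) that assoc mult_zero_left)
  have lc: "\<epsilon> b \<odot> \<epsilon> x = 0" if "x \<in> corner n" "b \<in> lower_diag n" for x b
    by (metis c(2) l(2) that assoc mult_zero_left)
  have uc: "\<epsilon> (a \<odot> x) = \<epsilon> a \<odot> \<epsilon> x" if "x \<in> corner n" "a \<in> upper_diag n" for x a
    using upper_corner(2) [OF that(2,1)] cu [OF that] by (simp add: bracket_eq)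
  have cl: "\<epsilon> (x \<odot> b) = \<epsilon> x \<odot> \<epsilon> b" if "x \<in> corner n" "b \<in> lower_diag n" for x b
    using corner_lower(2) [OF that(2,1)] lc [OF that] by (simp add: bracket_eq)
  have uu: "\<epsilon> (a \<odot> a') = \<epsilon> a \<odot> \<epsilon> a'" if a: "a \<in> upper_diag n" "a' \<in> upper_diag n" for a a'
  proof -
    let ?d = "\<epsilon> (a \<odot> a') - \<epsilon> a \<odot> \<epsilon> a'"
    note [simp] = upper_diagD(1) [OF a(1)] upper_diagD(1) [OF a(2)]
    have "?d \<odot> f = 0"
    proof (rule corner_faithful_left [OF f])
      fix y assume "y \<in> corner f"
      then obtain x where x: "x \<in> corner n" "\<epsilon> x = y" using \<epsilon>_corner_surj by blast
      have "\<epsilon> (a \<odot> a') \<odot> y = \<epsilon> (a \<odot> (a' \<odot> x))"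
        using uc [OF x(1) upper_upper [OF a]] x(2) by (simp add: assoc)
      also have "\<dots> = \<epsilon> a \<odot> (\<epsilon> a' \<odot> y)"
        using uc upper_corner(1) a x by simp
      finally show "?d \<odot> y = 0" by (simp add: mult_simps assoc)
    qed simp
    thus ?thesis
      using u [OF a(2)] u [OF upper_upper [OF a]] by (simp add: mult_simps assoc)
  qed
  have ll: "\<epsilon> (b \<odot> b') = \<epsilon> b \<odot> \<epsilon> b'" if b: "b \<in> lower_diag n" "b' \<in> lower_diag n" for b b'
  proof -
    let ?d = "\<epsilon> (b \<odot> b') - \<epsilon> b \<odot> \<epsilon> b'"
    note [simp] = lower_diagD(1) [OF b(1)] lower_diagD(1) [OF b(2)]
    have "(\<one> - f) \<odot> ?d = 0"
    proof (rule corner_faithful_right [OF f])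
      fix y assume "y \<in> corner f"
      then obtain x where x: "x \<in> corner n" "\<epsilon> x = y" using \<epsilon>_corner_surj by blast
      have "y \<odot> \<epsilon> (b \<odot> b') = \<epsilon> (x \<odot> b \<odot> b')"
        using cl [OF x(1) lower_lower [OF b]] x(2) by (simp add: assoc)
      also have "\<dots> = y \<odot> (\<epsilon> b \<odot> \<epsilon> b')"
        using cl corner_lower(1) b x by (simp add: assoc [symmetric])
      finally show "y \<odot> ?d = 0" by (simp add: mult_simps assoc)
    qed simp
    moreover have "f \<odot> (\<epsilon> b \<odot> \<epsilon> b') = 0"
      by (metis l(1) b(1) assoc mult_zero_left)
    ultimately show ?thesis
      using l [OF lower_lower [OF b]] by (simp add: mult_simps)
  qed
  have mult: "\<epsilon> (s \<odot> t) = \<epsilon> s \<odot> \<epsilon> t" if "s \<in> S" "t \<in> S" for s t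
  proof (rule mult_eq_by_blocks [OF n add_left add_right \<epsilon>_add uu _ _ ll _ _ _ _ _ that])
    show "\<epsilon> a \<odot> \<epsilon> b = 0" if "a \<in> upper_diag n" "b \<in> lower_diag n" for a b
      by (metis u(2) l(1) that assoc mult_zero_right)
    show "\<epsilon> b \<odot> \<epsilon> a = 0" if "b \<in> lower_diag n" "a \<in> upper_diag n" for a b
      by (metis u(1) l(2) that assoc mult_zero_left)
    show "\<epsilon> x \<odot> \<epsilon> x' = 0" if "x \<in> corner n" "x' \<in> corner n" for x x'
      by (metis c(2,3) that assoc mult_zero_left)
  qed (simp_all add: uc cl cu lc)
  \<comment> \<open>Otherwise \<open>\<epsilon>\<close> would be 0 on \<open>S\<close> although it
    maps onto \<open>corner f\<close>, which is nonzero by faithfulness.\<close>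
  have "\<epsilon> \<one> \<noteq> 0"
  proof
    assume "\<epsilon> \<one> = 0"
    hence "\<epsilon> x = 0" if "x \<in> S" for x using mult [OF unit_mem that] that by simp
    hence "y = 0" if "y \<in> corner f" for y using \<epsilon>_corner_surj [OF that] cornerD(1) by blast
    thus False using corner_faithful_left [OF f, of \<one>] fD(3) by force
  qed
  thus ?thesis
    using bij_betw_scalar_perturbation [OF \<kappa>_linear \<epsilon>_def] mult by (simp add: alg_automorphism_def)
qed

text \<open>Here the two diagonals change places: left multiplication by \<open>a\<close> on one
  corner becomes right multiplication by \<open>- \<epsilon> a\<close> on the other, so iterating it
  reverses the order of factors.\<close>

lemma neg_anti_automorphism:
  assumes upper: "\<And>a. a \<in> upper_diag n \<Longrightarrow> f \<odot> \<epsilon> a = 0"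
    and lower: "\<And>b. b \<in> lower_diag n \<Longrightarrow> (\<one> - f) \<odot> \<epsilon> b = 0"
  shows "alg_anti_automorphism mult S (\<lambda>x. - \<epsilon> x)"
proof -
  have u: "f \<odot> \<epsilon> a = 0" "\<epsilon> a \<odot> f = 0" if "a \<in> upper_diag n" for a
    using upper [OF that] upper_diagD [OF that] \<epsilon>_commutes [of a] by simp_all
  have l: "f \<odot> \<epsilon> b = \<epsilon> b" "\<epsilon> b \<odot> f = \<epsilon> b" if "b \<in> lower_diag n" for b
    using lower [OF that] lower_diagD [OF that] \<epsilon>_commutes [of b] by (simp_all add: mult_simps)
  note c = cornerD [OF \<epsilon>_corner]
  have uc0: "\<epsilon> a \<odot> \<epsilon> x = 0" if "x \<in> corner n" "a \<in> upper_diag n" for x a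
    by (metis c(2) u(2) that assoc mult_zero_left)
  have cl0: "\<epsilon> x \<odot> \<epsilon> b = 0" if "x \<in> corner n" "b \<in> lower_diag n" for x b
    by (metis c(3) l(1) that assoc mult_zero_left)
  have uc: "\<epsilon> (a \<odot> x) = - (\<epsilon> x \<odot> \<epsilon> a)" if "x \<in> corner n" "a \<in> upper_diag n" for x a
    using upper_corner(2) [OF that(2,1)] uc0 [OF that] by (simp add: bracket_eq)
  have cl: "\<epsilon> (x \<odot> b) = - (\<epsilon> b \<odot> \<epsilon> x)" if "x \<in> corner n" "b \<in> lower_diag n" for x b
    using corner_lower(2) [OF that(2,1)] cl0 [OF that] by (simp add: bracket_eq)
  have uu: "- \<epsilon> (a \<odot> a') = \<epsilon> a' \<odot> \<epsilon> a" if a: "a \<in> upper_diag n" "a' \<in> upper_diag n" for a a'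
  proof -
    let ?d = "\<epsilon> (a \<odot> a') + \<epsilon> a' \<odot> \<epsilon> a"
    note [simp] = upper_diagD(1) [OF a(1)] upper_diagD(1) [OF a(2)]
    have "(\<one> - f) \<odot> ?d = 0"
    proof (rule corner_faithful_right [OF f])
      fix y assume "y \<in> corner f"
      then obtain x where x: "x \<in> corner n" "\<epsilon> x = y" using \<epsilon>_corner_surj by blast
      have "- (y \<odot> \<epsilon> (a \<odot> a')) = \<epsilon> (a \<odot> (a' \<odot> x))"
        using uc [OF x(1) upper_upper [OF a]] x(2) by (simp add: assoc)
      also have "\<dots> = y \<odot> (\<epsilon> a' \<odot> \<epsilon> a)"
        using uc upper_corner(1) a x by (simp add: minus_left assoc)
      finally show "y \<odot> ?d = 0" by (simp add: mult_simps neg_eq_iff_add_eq_0)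
    qed simp
    moreover have "f \<odot> (\<epsilon> a' \<odot> \<epsilon> a) = 0"
      by (metis u(1) a(2) assoc mult_zero_left)
    ultimately show ?thesis
      using u [OF upper_upper [OF a]] by (simp add: mult_simps neg_eq_iff_add_eq_0)
  qed
  have ll: "- \<epsilon> (b \<odot> b') = \<epsilon> b' \<odot> \<epsilon> b" if b: "b \<in> lower_diag n" "b' \<in> lower_diag n" for b b'
  proof -
    let ?d = "\<epsilon> (b \<odot> b') + \<epsilon> b' \<odot> \<epsilon> b"
    note [simp] = lower_diagD(1) [OF b(1)] lower_diagD(1) [OF b(2)]
    have "?d \<odot> f = 0"
    proof (rule corner_faithful_left [OF f])
      fix y assume "y \<in> corner f"
      then obtain x where x: "x \<in> corner n" "\<epsilon> x = y" using \<epsilon>_corner_surj by blast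
      have "- (\<epsilon> (b \<odot> b') \<odot> y) = \<epsilon> (x \<odot> b \<odot> b')"
        using cl [OF x(1) lower_lower [OF b]] x(2) by (simp add: assoc)
      also have "\<dots> = \<epsilon> b' \<odot> \<epsilon> b \<odot> y"
        using cl corner_lower(1) b x by (simp add: minus_right flip: assoc)
      finally show "?d \<odot> y = 0" by (simp add: mult_simps neg_eq_iff_add_eq_0)
    qed simp
    thus ?thesis
      using l [OF lower_lower [OF b]] l [OF b(1)]
      by (simp add: mult_simps assoc neg_eq_iff_add_eq_0)
  qed
  have mult: "- \<epsilon> (s \<odot> t) = - \<epsilon> t \<odot> - \<epsilon> s" if "s \<in> S" "t \<in> S" for s t
  proof (rule mult_eq_by_blocks [OF n, where M = "\<lambda>x y. y \<odot> x" and \<phi> = "\<lambda>x. - \<epsilon> x"])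
    show "- \<epsilon> b \<odot> - \<epsilon> a = 0" if "a \<in> upper_diag n" "b \<in> lower_diag n" for a b
      by (simp add: minus_left minus_right)
        (metis u(1) [OF that(1)] l(2) [OF that(2)] assoc mult_zero_right)
    show "- \<epsilon> a \<odot> - \<epsilon> b = 0" if "b \<in> lower_diag n" "a \<in> upper_diag n" for a b
      by (simp add: minus_left minus_right)
        (metis u(2) [OF that(2)] l(1) [OF that(1)] assoc mult_zero_left)
    show "- \<epsilon> x' \<odot> - \<epsilon> x = 0" if "x \<in> corner n" "x' \<in> corner n" for x x'
      by (simp add: minus_left minus_right) (metis c(2,3) that assoc mult_zero_left)
  qed (simp_all add: uc cl uu ll uc0 cl0 that \<epsilon>_add add_left add_right minus_left minus_right)
  have "\<epsilon> \<one> \<noteq> 0"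
  proof
    assume "\<epsilon> \<one> = 0"
    hence "\<epsilon> x = 0" if "x \<in> S" for x using mult [OF unit_mem that] that by simp
    hence "y = 0" if "y \<in> corner f" for y using \<epsilon>_corner_surj [OF that] cornerD(1) by blast
    thus False using corner_faithful_left [OF f, of \<one>] fD(3) by force
  qed
  note bij = bij_betw_scalar_perturbation [OF \<kappa>_linear \<epsilon>_def this]
  have "bij_betw uminus S S"
    by (rule bij_betw_byWitness [where f' = uminus]) auto
  hence "bij_betw (\<lambda>x. - \<epsilon> x) S S"
    using bij_betw_trans [OF bij(2)] by (simp add: o_def)
  thus ?thesis
    using bij(1) mult by (simp add: alg_anti_automorphism_def clinear_on_def)
qed

end

context triangular_lie_automorphism
begin

lemma lie_automorphism_decomposition:
  "\<exists>\<epsilon> \<kappa>. (alg_automorphism mult S \<epsilon> \<or> alg_anti_automorphism mult S (\<lambda>x. - \<epsilon> x)) \<and>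
    clinear_on S \<kappa> \<and> (\<forall>x. \<epsilon> x = \<theta> x + \<kappa> x *\<^sub>C \<one>)"
proof -
  obtain n where n: "tri_idem n" using tri_idem_exists by blast
  then obtain f c where f: "tri_idem f" "\<theta> n = f + c *\<^sub>C \<one>" using \<theta>_tri_idem by blast
  interpret triangular_lie_blocks mult S \<one> \<theta> n f c
    by unfold_locales (use n f in auto)
  \<comment> \<open>Moves \<open>f\<close> in \<open>left_scalar\<close> to the left of
    \<open>\<theta> d\<close>, where \<open>scalar_correction\<close> expects it.\<close>
  have comm: "f \<odot> \<theta> d = \<theta> d \<odot> f" if "d \<in> upper_diag n \<union> lower_diag n" for d
    using that \<theta>_commutes_iff [of d] by (auto simp: upper_diag_def lower_diag_def)
  from diag_scalar_cases show ?thesis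
  proof
    assume "(\<forall>a\<in>upper_diag n. right_scalar a) \<and> (\<forall>b\<in>lower_diag n. left_scalar b)"
    hence "\<And>a. a \<in> upper_diag n \<Longrightarrow> \<exists>s. (\<one> - f) \<odot> \<theta> a = s *\<^sub>C (\<one> - f)"
      "\<And>b. b \<in> lower_diag n \<Longrightarrow> \<exists>s. f \<odot> \<theta> b = s *\<^sub>C f"
      using comm by (auto simp: left_scalar_def right_scalar_def)
    from scalar_correction [OF _ _ _ _ this] obtain \<kappa>
      where \<kappa>: "clinear_on S \<kappa>" "\<And>x. x \<in> corner n \<Longrightarrow> \<kappa> x = 0"
        "\<And>a. a \<in> upper_diag n \<Longrightarrow> (\<one> - f) \<odot> (\<theta> a + \<kappa> a *\<^sub>C \<one>) = 0"
        "\<And>b. b \<in> lower_diag n \<Longrightarrow> f \<odot> (\<theta> b + \<kappa> b *\<^sub>C \<one>) = 0"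
      using fD by auto
    interpret triangular_lie_correction mult S \<one> \<theta> n f c \<kappa> "\<lambda>x. \<theta> x + \<kappa> x *\<^sub>C \<one>"
      by unfold_locales (use \<kappa> in auto)
    show ?thesis
      by (intro exI [of _ "\<lambda>x. \<theta> x + \<kappa> x *\<^sub>C \<one>"] exI [of _ \<kappa>])
        (intro conjI disjI1 automorphism \<kappa>(1,3,4) allI refl)
  next
    assume "(\<forall>a\<in>upper_diag n. left_scalar a) \<and> (\<forall>b\<in>lower_diag n. right_scalar b)"
    hence "\<And>a. a \<in> upper_diag n \<Longrightarrow> \<exists>s. f \<odot> \<theta> a = s *\<^sub>C f"
      "\<And>b. b \<in> lower_diag n \<Longrightarrow> \<exists>s. (\<one> - f) \<odot> \<theta> b = s *\<^sub>C (\<one> - f)"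
      using comm by (auto simp: left_scalar_def right_scalar_def)
    from scalar_correction [OF _ _ _ _ this] obtain \<kappa>
      where \<kappa>: "clinear_on S \<kappa>" "\<And>x. x \<in> corner n \<Longrightarrow> \<kappa> x = 0"
        "\<And>a. a \<in> upper_diag n \<Longrightarrow> f \<odot> (\<theta> a + \<kappa> a *\<^sub>C \<one>) = 0"
        "\<And>b. b \<in> lower_diag n \<Longrightarrow> (\<one> - f) \<odot> (\<theta> b + \<kappa> b *\<^sub>C \<one>) = 0"
      using fD by auto
    interpret triangular_lie_correction mult S \<one> \<theta> n f c \<kappa> "\<lambda>x. \<theta> x + \<kappa> x *\<^sub>C \<one>"
      by unfold_locales (use \<kappa> in auto)
    show ?thesis
      by (intro exI [of _ "\<lambda>x. \<theta> x + \<kappa> x *\<^sub>C \<one>"] exI [of _ \<kappa>])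
        (intro conjI disjI2 neg_anti_automorphism \<kappa>(1,3,4) allI refl)
  qed
qed

end

section \<open>Orthogonal projections\<close>

lemma cinner_add_right: "cinner x (y + z) = cinner x y + cinner x z"
  by (metis cinner_add_left cinner_commute complex_cnj_add)

lemma cinner_scaleC_right: "cinner x (c *\<^sub>C y) = cnj c * cinner x y"
  by (metis cinner_commute cinner_scaleC_left complex_cnj_mult)

lemma cinner_zero_left [simp]: "cinner 0 y = 0"
  using cinner_add_left [of 0 0 y] by simp

lemma cinner_zero_right [simp]: "cinner x 0 = 0"
  using cinner_add_right [of x 0 0] by simp

lemma cinner_diff_left: "cinner (x - y) z = cinner x z - cinner y z"
  by (metis cinner_add_left eq_diff_eq)

lemma cinner_diff_right: "cinner x (y - z) = cinner x y - cinner x z"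
  by (metis cinner_add_right eq_diff_eq)

lemma cinner_self_eq_0_iff: "cinner x x = 0 \<longleftrightarrow> x = 0"
  by (metis cinner_zero_left inner_cinner inner_eq_zero_iff zero_complex.sel(1))

lemma cmod_cinner_le: "cmod (cinner x y) \<le> norm x * norm y"
proof (cases "cinner x y = 0")
  case False
  \<comment> \<open>A unimodular factor that rotates the inner product onto the positive real axis,
    so that the real Cauchy-Schwarz inequality applies.\<close>
  define c where "c = cnj (cinner x y) / cmod (cinner x y)"
  have "cinner (c *\<^sub>C x) y = cmod (cinner x y)"
    using False by (simp add: cinner_scaleC_left c_def field_simps complex_norm_square
        power2_eq_square flip: of_real_mult)
      (metis complex_norm_square mult.commute of_real_mult power2_eq_square)
  hence "cmod (cinner x y) = inner (c *\<^sub>C x) y"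
    by (simp add: inner_cinner)
  also have "\<dots> \<le> norm (c *\<^sub>C x) * norm y"
    by (rule norm_cauchy_schwarz)
  also have "norm (c *\<^sub>C x) = norm x"
    using False by (simp add: norm_scaleC c_def norm_divide)
  finally show ?thesis .
qed simp

text \<open>One Gram-Schmidt step: the component of \<open>q\<close> orthogonal to \<open>p\<close>,
  suitably normalised.\<close>

lemma orthogonal_vector_exists:
  assumes "\<And>s. q \<noteq> s *\<^sub>C p"
  shows "\<exists>z. cinner p z = 0 \<and> cinner q z = 1"
proof -
  define k where "k = cinner q p / cinner p p"
  define w where "w = q - k *\<^sub>C p"
  have w: "cinner w w \<noteq> 0"
    using assms [of k] by (simp add: w_def cinner_self_eq_0_iff)
  have pw: "cinner p w = 0"
  proof (cases "p = 0")
    case False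
    hence "cnj k * cinner p p = cinner p q"
      by (metis cinner_commute cinner_self_eq_0_iff complex_cnj_mult k_def nonzero_eq_divide_eq)
    thus ?thesis by (simp add: w_def cinner_diff_right cinner_scaleC_right)
  qed simp
  have "cinner w w = cinner q w"
    using pw by (metis cinner_diff_left cinner_scaleC_left diff_zero mult_zero_right w_def)
  moreover have "cnj (cinner w w) = cinner w w"
    by (metis cinner_commute)
  ultimately have "cinner q ((1 / cinner w w) *\<^sub>C w) = 1" "cinner p ((1 / cinner w w) *\<^sub>C w) = 0"
    using w pw by (simp_all add: cinner_scaleC_right)
  thus ?thesis by blast
qed

text \<open>The vector sought is the nearest point of \<open>M\<close>, obtained as the limit of a
  minimising sequence.\<close>

lemma closed_subspace_orthogonal_decomposition:
  fixes M :: "'a::{real_inner, complete_space} set"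
  assumes "subspace M" "closed M"
  shows "\<exists>y\<in>M. \<forall>m\<in>M. inner (x - y) m = 0"
proof -
  define d where "d = infdist x M"
  have M: "M \<noteq> {}" using subspace_0 [OF assms(1)] by blast
  have d: "d\<^sup>2 \<le> (norm (x - m))\<^sup>2" if "m \<in> M" for m
    using infdist_le [OF that, of x] infdist_nonneg [of x M]
    by (simp add: d_def dist_norm power_mono)
  have "\<exists>m\<in>M. (norm (x - m))\<^sup>2 < d\<^sup>2 + inverse (real (Suc k))" for k
  proof -
    have "d < sqrt (d\<^sup>2 + inverse (real (Suc k)))"
      by (rule real_less_rsqrt) simp
    then obtain m where m: "m \<in> M" "dist x m < sqrt (d\<^sup>2 + inverse (real (Suc k)))"
      using cInf_lessD [of "dist x ` M" "sqrt (d\<^sup>2 + inverse (real (Suc k)))"] M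
      by (auto simp: d_def infdist_notempty)
    hence "(norm (x - m))\<^sup>2 < (sqrt (d\<^sup>2 + inverse (real (Suc k))))\<^sup>2"
      by (intro power_strict_mono) (auto simp: dist_norm)
    with m(1) show ?thesis by (auto simp: add_nonneg_nonneg)
  qed
  then obtain y where y: "\<And>k. y k \<in> M" "\<And>k. (norm (x - y k))\<^sup>2 < d\<^sup>2 + inverse (real (Suc k))"
    by metis
  have close: "(dist (y i) (y j))\<^sup>2 \<le> 2 * inverse (real (Suc i)) + 2 * inverse (real (Suc j))" for i j
  proof -
    let ?m = "(1/2) *\<^sub>R (y i + y j)"
    have "?m \<in> M" using assms(1) y(1) by (intro subspace_scale subspace_add) auto
    hence "4 * d\<^sup>2 \<le> 4 * (norm (x - ?m))\<^sup>2" using d by simp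
    \<comment> \<open>Parallelogram law for \<open>x - y i\<close> and \<open>x - y j\<close>; the
      midpoint is no closer to \<open>x\<close> than \<open>d\<close>, which makes the sequence
      Cauchy.\<close>
    moreover have "(dist (y i) (y j))\<^sup>2 + 4 * (norm (x - ?m))\<^sup>2
        = 2 * (norm (x - y i))\<^sup>2 + 2 * (norm (x - y j))\<^sup>2"
      by (simp add: dist_norm power2_norm_eq_inner inner_diff_left inner_diff_right
          inner_add_left inner_add_right inner_commute algebra_simps)
    ultimately show ?thesis using y(2) [of i] y(2) [of j] by linarith
  qed
  have "Cauchy y"
  proof (rule metric_CauchyI)
    fix e :: real assume "e > 0"
    then obtain K where K: "inverse (real (Suc K)) < e\<^sup>2 / 4"
      using reals_Archimedean [of "e\<^sup>2 / 4"] by auto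
    have "dist (y i) (y j) < e" if "K \<le> i" "K \<le> j" for i j
    proof -
      have "inverse (real (Suc i)) \<le> inverse (real (Suc K))"
        "inverse (real (Suc j)) \<le> inverse (real (Suc K))"
        using that by (simp_all add: le_imp_inverse_le)
      hence "(dist (y i) (y j))\<^sup>2 < e\<^sup>2"
        using close [of i j] K by linarith
      thus ?thesis
        using \<open>e > 0\<close> by (simp add: power2_less_imp_less)
    qed
    thus "\<exists>K. \<forall>i\<ge>K. \<forall>j\<ge>K. dist (y i) (y j) < e" by blast
  qed
  then obtain l where l: "y \<longlonglongrightarrow> l"
    using Cauchy_convergent_iff convergent_def by blast
  have lM: "l \<in> M"
    using closed_sequentially [OF assms(2) _ l] y(1) by blast
  have l_le: "(norm (x - l))\<^sup>2 \<le> d\<^sup>2 + 0"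
  proof (rule LIMSEQ_le)
    show "(\<lambda>k. (norm (x - y k))\<^sup>2) \<longlonglongrightarrow> (norm (x - l))\<^sup>2"
      by (intro tendsto_intros l)
    show "(\<lambda>k. d\<^sup>2 + inverse (real (Suc k))) \<longlonglongrightarrow> d\<^sup>2 + 0"
      by (intro tendsto_intros LIMSEQ_inverse_real_of_nat)
    show "\<exists>N. \<forall>n\<ge>N. (norm (x - y n))\<^sup>2 \<le> d\<^sup>2 + inverse (real (Suc n))"
      using y(2) less_imp_le by blast
  qed
  have min: "(norm (x - l))\<^sup>2 \<le> (norm (x - m))\<^sup>2" if "m \<in> M" for m
    using l_le d [OF that] by linarith
  have "inner (x - l) m = 0" if m: "m \<in> M" for m
  proof (cases "m = 0")
    case False
    \<comment> \<open>The minimiser of the squared norm of \<open>x - l - t m\<close> as a quadratic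
      in \<open>t\<close>.\<close>
    define t where "t = inner (x - l) m / inner m m"
    have mm: "inner m m > 0" using False by simp
    have "l + t *\<^sub>R m \<in> M" using assms(1) lM m by (intro subspace_add subspace_scale)
    from min [OF this] have "0 \<le> - 2 * t * inner (x - l) m + t * t * inner m m"
      by (simp add: power2_norm_eq_inner inner_diff_left inner_diff_right
          inner_add_left inner_add_right inner_commute algebra_simps)
    also have "\<dots> = - ((inner (x - l) m)\<^sup>2 / inner m m)"
      using mm by (simp add: t_def power2_eq_square field_simps)
    finally have "(inner (x - l) m)\<^sup>2 / inner m m \<le> 0" by simp
    thus ?thesis
      using mm by (simp add: divide_le_0_iff)
  qed simp
  with lM show ?thesis by blast
qed

lemma projectionsD:
  assumes "P \<in> projections"
  shows "P \<in> bounded_ops" "P (P x) = P x" "cinner (P x) y = cinner x (P y)"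
  using assms by (auto simp: projections_def) (metis blinfun_apply_blinfun_compose)

lemma mem_ran_iff:
  assumes "P \<in> projections"
  shows "x \<in> ran P \<longleftrightarrow> P x = x"
  unfolding ran_def by (metis projectionsD(2) [OF assms] rangeE rangeI)

lemma bounded_ops_scaleC:
  fixes T :: "'a::complex_inner \<Rightarrow>\<^sub>L 'a"
  shows "T \<in> bounded_ops \<Longrightarrow> T (c *\<^sub>C x) = c *\<^sub>C T x"
  by (auto simp: bounded_ops_def clinear_on_def)

lemma bounded_opsI:
  fixes T :: "'a::complex_inner \<Rightarrow>\<^sub>L 'a"
  shows "(\<And>c x. T (c *\<^sub>C x) = c *\<^sub>C T x) \<Longrightarrow> T \<in> bounded_ops"
  by (auto simp: bounded_ops_def clinear_on_def blinfun.add_right)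

lemma projection_exists:
  fixes M :: "'a::complex_hilbert set"
  assumes M: "0 \<in> M" "\<And>x y. x \<in> M \<Longrightarrow> y \<in> M \<Longrightarrow> x + y \<in> M" "\<And>c x. x \<in> M \<Longrightarrow> c *\<^sub>C x \<in> M"
    and closed: "closed M"
  shows "\<exists>P\<in>projections. ran P = M"
proof -
  have sub: "subspace M"
    using M by (simp add: subspace_def scaleR_scaleC)
  have diff: "x - y \<in> M" if "x \<in> M" "y \<in> M" for x y
    using subspace_diff [OF sub that] .
  have "\<exists>y\<in>M. \<forall>m\<in>M. cinner (x - y) m = 0" for x
  proof -
    obtain y where y: "y \<in> M" "\<And>m. m \<in> M \<Longrightarrow> inner (x - y) m = 0"
      using closed_subspace_orthogonal_decomposition [OF sub closed] by blast
    \<comment> \<open>Real orthogonality to \<open>m\<close> and to \<open>\<i> m\<close> gives the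
      real and the imaginary part.\<close>
    have "cinner (x - y) m = 0" if "m \<in> M" for m
      using y(2) [OF that] y(2) [OF M(3) [OF that, of \<i>]]
      by (simp add: inner_cinner cinner_scaleC_right complex_eq_iff)
    with y(1) show ?thesis by blast
  qed
  then obtain p where p: "\<And>x. p x \<in> M" "\<And>x m. m \<in> M \<Longrightarrow> cinner (x - p x) m = 0"
    by metis
  have p': "cinner (p x) m = cinner x m" if "m \<in> M" for x m
    using p(2) [OF that, of x] by (simp add: cinner_diff_left)
  have unique: "p x = y" if y: "y \<in> M" and orth: "\<And>m. m \<in> M \<Longrightarrow> cinner y m = cinner x m" for x y
  proof -
    have "p x - y \<in> M" using p(1) y by (rule diff)
    hence "cinner (p x - y) (p x - y) = 0"
      by (simp add: cinner_diff_left p' orth)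
    thus ?thesis by (simp add: cinner_self_eq_0_iff)
  qed
  have add: "p (x + y) = p x + p y" for x y
    by (rule unique) (use p M in \<open>auto simp: cinner_add_left p'\<close>)
  have scale: "p (c *\<^sub>C x) = c *\<^sub>C p x" for c x
    by (rule unique) (use p M in \<open>auto simp: cinner_scaleC_left p'\<close>)
  have fix_M: "p x = x" if "x \<in> M" for x
    by (rule unique) (use that in auto)
  have bl: "bounded_linear p"
  proof (rule bounded_linear_intro)
    show "norm (p x) \<le> norm x * 1" for x
    proof -
      have "norm (p x) * norm (p x) = inner x (p x)"
        using p' [OF p(1), of x x] by (metis inner_cinner norm_eq_sqrt_inner inner_ge_zero real_sqrt_mult_self abs_of_nonneg)
      also have "\<dots> \<le> norm x * norm (p x)" by (rule norm_cauchy_schwarz)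
      finally show ?thesis
        by (cases "p x = 0") auto
    qed
  qed (simp_all add: add scale scaleR_scaleC)
  define P where "P = Blinfun p"
  have P: "blinfun_apply P = p"
    by (simp add: P_def bounded_linear_Blinfun_apply [OF bl])
  have "P \<in> projections"
    unfolding projections_def
  proof (intro CollectI conjI allI)
    show "P \<in> bounded_ops" by (rule bounded_opsI) (simp add: P scale)
    show "P o\<^sub>L P = P" by (rule blinfun_eqI) (simp add: P fix_M p(1))
    show "cinner (P x) y = cinner x (P y)" for x y
      by (metis P p' p(1) cinner_commute)
  qed
  moreover have "ran P = M"
    by (auto simp: ran_def P p(1)) (metis fix_M rangeI)
  ultimately show ?thesis by blast
qed

lemma projection_unique:
  assumes P: "P \<in> projections" and Q: "Q \<in> projections" and ran: "ran P = ran Q"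
  shows "P = Q"
proof (rule blinfun_eqI)
  fix x
  have PQ: "P (Q y) = Q y" and QP: "Q (P y) = P y" for y
    by (metis mem_ran_iff [OF P] mem_ran_iff [OF Q] ran projectionsD(2) P Q)+
  have "cinner (P x) y = cinner (Q x) y" for y
    by (metis P Q PQ QP projectionsD(3))
  hence "cinner (P x - Q x) (P x - Q x) = 0"
    by (simp add: cinner_diff_left)
  thus "P x = Q x" by (simp add: cinner_self_eq_0_iff)
qed

text \<open>Justifies the definite description in \<open>proj_onto\<close>: the closure of a span is
  a closed complex subspace and so the range of exactly one projection.\<close>

lemma proj_Sup_projection:
  fixes S :: "('a::complex_hilbert \<Rightarrow>\<^sub>L 'a) set"
  shows "proj_Sup S \<in> projections" "ran (proj_Sup S) = closure (cspan (\<Union>P\<in>S. ran P))"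
proof -
  let ?V = "cspan (\<Union>P\<in>S. ran P)"
  have add: "x + y \<in> closure ?V" if xy: "x \<in> closure ?V" "y \<in> closure ?V" for x y
  proof -
    obtain u w where "\<And>n. u n \<in> ?V" "u \<longlonglongrightarrow> x" "\<And>n. w n \<in> ?V" "w \<longlonglongrightarrow> y"
      using xy unfolding closure_sequential by blast
    hence "(\<forall>n. u n + w n \<in> ?V) \<and> (\<lambda>n. u n + w n) \<longlonglongrightarrow> x + y"
      by (simp add: complex_vector.span_add tendsto_add)
    thus ?thesis
      unfolding closure_sequential by (intro exI [of _ "\<lambda>n. u n + w n"])
  qed
  have scale: "c *\<^sub>C x \<in> closure ?V" if x: "x \<in> closure ?V" for c x
  proof -
    obtain u where "\<And>n. u n \<in> ?V" "u \<longlonglongrightarrow> x"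
      using x unfolding closure_sequential by blast
    hence "(\<forall>n. c *\<^sub>C u n \<in> ?V) \<and> (\<lambda>n. c *\<^sub>C u n) \<longlonglongrightarrow> c *\<^sub>C x"
      by (simp add: complex_vector.span_scale bounded_linear.tendsto [OF bounded_linear_scaleC])
    thus ?thesis
      unfolding closure_sequential by (intro exI [of _ "\<lambda>n. c *\<^sub>C u n"])
  qed
  have zero: "0 \<in> closure ?V"
    using complex_vector.span_zero closure_subset by blast
  have "\<exists>P\<in>projections. ran P = closure ?V"
    by (rule projection_exists) (use zero add scale in auto)
  hence "\<exists>!P. P \<in> projections \<and> ran P = closure ?V"
    using projection_unique by metis
  from theI' [OF this] show "proj_Sup S \<in> projections" "ran (proj_Sup S) = closure ?V"
    by (simp_all add: proj_Sup_def proj_onto_def)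
qed

lemma proj_le_proj_Sup:
  fixes P :: "'a::complex_hilbert \<Rightarrow>\<^sub>L 'a"
  assumes "P \<in> S"
  shows "proj_le P (proj_Sup S)"
  using assms complex_vector.span_superset [of "\<Union>P\<in>S. ran P"] closure_subset
  by (fastforce simp: proj_le_def proj_Sup_projection)


section \<open>Nest algebras are triangular\<close>

definition rank_one :: "'a::complex_inner \<Rightarrow> 'a \<Rightarrow> 'a \<Rightarrow>\<^sub>L 'a" where
  "rank_one x z = Blinfun (\<lambda>v. cinner v z *\<^sub>C x)"

lemma rank_one_apply [simp]: "rank_one x z v = cinner v z *\<^sub>C x"
proof -
  have "bounded_linear (\<lambda>v. cinner v z *\<^sub>C x)"
  proof (rule bounded_linear_intro)
    show "norm (cinner v z *\<^sub>C x) \<le> norm v * (norm z * norm x)" for v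
      using mult_right_mono [OF cmod_cinner_le [of v z], of "norm x"]
      by (simp add: norm_scaleC mult.assoc)
  qed (simp_all add: cinner_add_left scaleC_add_left scaleR_scaleC cinner_scaleC_left scaleC_scaleC)
  thus ?thesis
    by (simp add: rank_one_def bounded_linear_Blinfun_apply)
qed

text \<open>The factor at one \<open>u\<close> with \<open>G u\<close> nonzero works everywhere. If
  \<open>G v\<close> is parallel to \<open>G u\<close>, a suitable \<open>v - t u\<close> is killed
  by \<open>G\<close>, hence by \<open>C\<close>; otherwise independence of \<open>G u\<close> and
  \<open>G v\<close> in the relation at \<open>v + u\<close> equates the factors.\<close>

lemma locally_scalar_imp_scalar:
  fixes G C :: "'a::complex_vector \<Rightarrow> 'b::complex_vector"
  assumes G: "clinear_on UNIV G" and C: "clinear_on UNIV C" and local: "\<And>v. \<exists>s. C v = s *\<^sub>C G v"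
  shows "\<exists>s. \<forall>v. C v = s *\<^sub>C G v"
proof (cases "\<forall>v. G v = 0")
  case True
  thus ?thesis using local by auto
next
  case False
  then obtain u where u: "G u \<noteq> 0" by blast
  obtain s where s: "C u = s *\<^sub>C G u" using local by blast
  have lin: "G (v + w) = G v + G w" "G (c *\<^sub>C v) = c *\<^sub>C G v"
    "C (v + w) = C v + C w" "C (c *\<^sub>C v) = c *\<^sub>C C v" for v w c
    using G C by (simp_all add: clinear_on_def)
  have "C v = s *\<^sub>C G v" for v
  proof (cases "\<exists>t. G v = t *\<^sub>C G u")
    case True
    then obtain t where t: "G v = t *\<^sub>C G u" by blast
    have "G (v + (- t) *\<^sub>C u) = G v + (- t) *\<^sub>C G u" by (simp only: lin)
    hence "G (v + (- t) *\<^sub>C u) = 0" using t by simp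
    moreover obtain r where "C (v + (- t) *\<^sub>C u) = r *\<^sub>C G (v + (- t) *\<^sub>C u)" using local by blast
    moreover have "C (v + (- t) *\<^sub>C u) = C v + (- t) *\<^sub>C C u" by (simp only: lin)
    ultimately have "C v + (- t) *\<^sub>C C u = 0" by simp
    thus ?thesis by (simp add: s t scaleC_scaleC mult.commute)
  next
    case False
    obtain r where r: "C v = r *\<^sub>C G v" using local by blast
    obtain q where "C (v + u) = q *\<^sub>C G (v + u)" using local by blast
    hence "r *\<^sub>C G v + s *\<^sub>C G u = q *\<^sub>C G v + q *\<^sub>C G u"
      using lin r s by (simp add: scaleC_add_right)
    hence eq: "(r - q) *\<^sub>C G v = (q - s) *\<^sub>C G u"
      by (simp add: complex_vector.scale_left_diff_distrib algebra_simps)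
    have "r = q"
    proof (rule ccontr)
      assume "r \<noteq> q"
      hence "G v = ((q - s) / (r - q)) *\<^sub>C G u"
        using arg_cong [OF eq, of "\<lambda>x. (1 / (r - q)) *\<^sub>C x"] by (simp add: scaleC_scaleC scaleC_one)
      with False show False by blast
    qed
    with eq u r show ?thesis by (simp add: complex_vector.scale_eq_0_iff)
  qed
  thus ?thesis by blast
qed

locale subspace_chain =
  fixes E :: "'a::complex_hilbert \<Rightarrow>\<^sub>L 'a" and \<M> :: "('a \<Rightarrow>\<^sub>L 'a) set"
  assumes E: "E \<in> projections" and \<M>: "\<M> \<subseteq> projections"
    and below: "N \<in> \<M> \<Longrightarrow> proj_le N E"
    and chain: "N \<in> \<M> \<Longrightarrow> M \<in> \<M> \<Longrightarrow> proj_le N M \<or> proj_le M N"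
    and nontrivial: "\<exists>N\<in>\<M>. N \<noteq> 0 \<and> N \<noteq> E"
begin

abbreviation "\<A> \<equiv> nest_algebra E \<M>"

lemma \<M>_proj: "N \<in> \<M> \<Longrightarrow> N \<in> projections"
  using \<M> by blast

lemma E_fixes: "N \<in> \<M> \<Longrightarrow> E (N x) = N x"
  using below [of N] by (auto simp: proj_le_def mem_ran_iff E \<M>_proj projectionsD subset_iff)

lemma mem_algebra_iff:
  "T \<in> \<A> \<longleftrightarrow> T \<in> bounded_ops \<and> (\<forall>v. E (T v) = T v) \<and> (\<forall>v. T (E v) = T v) \<and>
    (\<forall>N\<in>\<M>. \<forall>v. N v = v \<longrightarrow> N (T v) = T v)"
proof -
  have "E o\<^sub>L T = T \<longleftrightarrow> (\<forall>v. E (T v) = T v)" "T o\<^sub>L E = T \<longleftrightarrow> (\<forall>v. T (E v) = T v)"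
    by (auto intro!: blinfun_eqI dest: arg_cong [where f = blinfun_apply] simp: fun_eq_iff
        simp flip: blinfun_apply_blinfun_compose)
  moreover have "T ` ran N \<subseteq> ran N \<longleftrightarrow> (\<forall>v. N v = v \<longrightarrow> N (T v) = T v)" if "N \<in> \<M>" for N
    by (auto simp: image_subset_iff mem_ran_iff [OF \<M>_proj [OF that]])
  ultimately show ?thesis
    by (simp add: nest_algebra_def ops_on_def)
qed

sublocale complex_algebra "(o\<^sub>L)" \<A> E
proof
  note [simp] = blinfun.add_left blinfun.add_right
  fix x y z :: "'a \<Rightarrow>\<^sub>L 'a"
  show "x o\<^sub>L y o\<^sub>L z = x o\<^sub>L (y o\<^sub>L z)" "(x + y) o\<^sub>L z = (x o\<^sub>L z) + (y o\<^sub>L z)"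
    "z o\<^sub>L (x + y) = (z o\<^sub>L x) + (z o\<^sub>L y)"
    by (rule blinfun_eqI; simp)+
  show "E \<in> \<A>"
    using E_fixes by (auto simp: mem_algebra_iff projectionsD [OF E]) metis+
  fix c
  assume x: "x \<in> \<A>"
  show "c *\<^sub>C x \<in> \<A>"
    using x by (auto simp: mem_algebra_iff bounded_ops_scaleC [OF projectionsD(1)] E \<M>_proj
        intro!: bounded_opsI) (simp add: bounded_ops_scaleC scaleC_scaleC mult.commute)
  show "E o\<^sub>L x = x" "x o\<^sub>L E = x"
    using x by (auto simp: mem_algebra_iff intro: blinfun_eqI)
  assume y: "y \<in> \<A>"
  show "x + y \<in> \<A>" "x o\<^sub>L y \<in> \<A>"
    using x y by (auto simp: mem_algebra_iff bounded_ops_scaleC scaleC_add_right intro!: bounded_opsI)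
  show "(c *\<^sub>C x) o\<^sub>L y = c *\<^sub>C (x o\<^sub>L y)" "x o\<^sub>L c *\<^sub>C y = c *\<^sub>C (x o\<^sub>L y)"
    using x by (auto simp: mem_algebra_iff bounded_ops_scaleC intro: blinfun_eqI)
qed

text \<open>
  The range of \<open>f\<close> is invariant under the nest algebra, hence comparable with the range of every
  member of the nest; that is all of the reflexivity of nests that is needed.
\<close>

lemma tri_idem_comparable:
  assumes f: "tri_idem f" and N: "N \<in> \<M>"
  shows "(\<forall>h. N h = h \<longrightarrow> f h = h) \<or> (\<forall>v. N (f v) = f v)"
proof (rule disjCI)
  note fD = tri_idemD [OF f]
  note f\<A> = fD(1) [unfolded mem_algebra_iff] and NP = projectionsD [OF \<M>_proj [OF N]]
  assume "\<not> (\<forall>v. N (f v) = f v)"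
  then obtain v where v: "N (f v) \<noteq> f v" by blast
  \<comment> \<open>The part of \<open>f v\<close> orthogonal to \<open>ran N\<close>. It makes
    \<open>rank_one h w\<close> send \<open>f v\<close> to a nonzero multiple of
    \<open>h\<close>.\<close>
  define w where "w = f v - N (f v)"
  have w: "w \<noteq> 0" "N w = 0" "E w = w"
    using v f\<A> E_fixes [OF N] by (auto simp: w_def blinfun.diff_right NP)
  have fvw: "cinner (f v) w = cinner w w"
    using w(2) by (metis NP(3) cinner_diff_left cinner_zero_right diff_zero w_def)
  show "\<forall>h. N h = h \<longrightarrow> f h = h"
  proof (intro allI impI)
    fix h assume h: "N h = h"
    \<comment> \<open>A member above \<open>N\<close> contains \<open>h\<close>; a member below
      \<open>N\<close> is orthogonal to \<open>w\<close>, so the operator vanishes on it.\<close>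
    have "rank_one h w \<in> \<A>"
      unfolding mem_algebra_iff
    proof (intro conjI allI ballI impI)
      show "rank_one h w \<in> bounded_ops"
        by (rule bounded_opsI) (simp add: cinner_scaleC_left scaleC_scaleC)
      show "E (rank_one h w x) = rank_one h w x" for x
        using E_fixes [OF N, of h] by (simp add: h bounded_ops_scaleC projectionsD [OF E])
      show "rank_one h w (E x) = rank_one h w x" for x
        by (simp add: projectionsD [OF E] w)
      fix M x assume M: "M \<in> \<M>" and x: "M x = x"
      note MP = projectionsD [OF \<M>_proj [OF M]]
      from chain [OF N M] show "M (rank_one h w x) = rank_one h w x"
      proof
        assume "proj_le N M"
        hence "M h = h"
          using h by (auto simp: proj_le_def subset_iff mem_ran_iff \<M>_proj N M)
        thus ?thesis by (simp add: bounded_ops_scaleC MP)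
      next
        assume "proj_le M N"
        hence "N x = x"
          using x by (auto simp: proj_le_def subset_iff mem_ran_iff \<M>_proj N M)
        hence "cinner x w = 0" by (metis NP(3) w(2) cinner_zero_right)
        thus ?thesis by simp
      qed
    qed
    hence "f o\<^sub>L (rank_one h w o\<^sub>L f) = rank_one h w o\<^sub>L f"
      by (rule fD(5))
    hence "f (rank_one h w (f v)) = rank_one h w (f v)"
      by (metis blinfun_apply_blinfun_compose)
    hence "cinner w w *\<^sub>C f h = cinner w w *\<^sub>C h"
      using f\<A> by (simp add: fvw bounded_ops_scaleC)
    thus "f h = h"
      using w(1) by (simp add: complex_vector.scale_cancel_left cinner_self_eq_0_iff)
  qed
qed

text \<open>By comparability, \<open>E - f\<close> kills \<open>ran N\<close> or else
  \<open>ran f\<close> lies in \<open>ran N\<close>; in both cases \<open>N\<close> is respected,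
  whatever \<open>x\<close> and \<open>z\<close> are.\<close>

lemma rank_one_corner:
  assumes f: "tri_idem f"
  shows "f o\<^sub>L rank_one x z o\<^sub>L (E - f) \<in> corner f"
proof -
  note fD = tri_idemD [OF f]
  note f\<A> = fD(1) [unfolded mem_algebra_iff]
  have ff: "f (f v) = f v" for v
    by (metis fD(2) blinfun_apply_blinfun_compose)
  have "f o\<^sub>L rank_one x z o\<^sub>L (E - f) \<in> \<A>" (is "?y \<in> _")
    unfolding mem_algebra_iff
  proof (intro conjI allI ballI impI)
    show "?y \<in> bounded_ops"
      by (rule bounded_opsI) (use f\<A> in \<open>simp add: bounded_ops_scaleC projectionsD(1) [OF E]
        blinfun.diff_left cinner_diff_left cinner_scaleC_left scaleC_scaleC right_diff_distrib\<close>)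
    show "E (?y v) = ?y v" "?y (E v) = ?y v" for v
      using f\<A> by (simp_all add: blinfun.diff_left projectionsD(2) [OF E])
    fix N v assume N: "N \<in> \<M>" and v: "N v = v"
    from tri_idem_comparable [OF f N] show "N (?y v) = ?y v"
    proof
      assume "\<forall>h. N h = h \<longrightarrow> f h = h"
      hence "(E - f) v = 0"
        using v E_fixes [OF N, of v] by (simp add: blinfun.diff_left)
      thus ?thesis by simp
    qed simp
  qed
  moreover have "f o\<^sub>L ?y = ?y"
    by (rule blinfun_eqI) (simp add: ff)
  moreover have "?y o\<^sub>L f = 0"
    by (rule blinfun_eqI) (use f\<A> in \<open>simp add: blinfun.diff_left ff\<close>)
  ultimately show ?thesis by (simp add: corner_def)
qed

sublocale triangular_algebra "(o\<^sub>L)" \<A> E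
proof
  fix f assume f: "tri_idem f"
  note fD = tri_idemD [OF f]
  note f\<A> = fD(1) [unfolded mem_algebra_iff]
  let ?g = "E - f"
  have g: "?g \<in> bounded_ops"
    by (rule bounded_opsI) (use f\<A> in \<open>simp add: blinfun.diff_left bounded_ops_scaleC
        projectionsD(1) [OF E] complex_vector.scale_right_diff_distrib\<close>)
  obtain x0 where x0: "f x0 \<noteq> 0"
    using fD(3) blinfun_eqI [of f 0] by auto
  obtain v0 where v0: "?g v0 \<noteq> 0"
    using fD(4) blinfun_eqI [of ?g 0] by auto
  {
    fix p b c d
    assume S: "p \<in> \<A>" "b \<in> \<A>" "c \<in> \<A>" "d \<in> \<A>"
      and eq: "\<And>y. y \<in> corner f \<Longrightarrow> (p o\<^sub>L y) + (b o\<^sub>L y o\<^sub>L c) + (y o\<^sub>L d) = 0"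
    note bl = S [unfolded mem_algebra_iff]
    \<comment> \<open>The hypothesis tested on the rank-one corner elements and evaluated at
      \<open>v\<close>; \<open>x\<close>, \<open>z\<close> and \<open>v\<close> vary
      independently.\<close>
    have pt: "cinner (?g v) z *\<^sub>C p (f x) + cinner (?g (c v)) z *\<^sub>C b (f x) + cinner (?g (d v)) z *\<^sub>C f x = 0"
      for x z v
      using arg_cong [OF eq [OF rank_one_corner [OF f, of x z]], of "\<lambda>T. blinfun_apply T v"] bl f\<A>
      by (simp add: blinfun.add_left bounded_ops_scaleC)
    show "(\<exists>s. b o\<^sub>L f = s *\<^sub>C f) \<or> (\<exists>s. ?g o\<^sub>L c = s *\<^sub>C ?g)"
    proof (cases "\<forall>v. \<exists>s. ?g (c v) = s *\<^sub>C ?g v")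
      case True
      have "\<exists>s. \<forall>v. (?g o\<^sub>L c) v = s *\<^sub>C ?g v"
        by (rule locally_scalar_imp_scalar)
          (use True g bl in \<open>auto simp: clinear_on_def blinfun.add_right bounded_ops_scaleC\<close>)
      then obtain s where "\<And>v. (?g o\<^sub>L c) v = s *\<^sub>C ?g v" by blast
      hence "?g o\<^sub>L c = s *\<^sub>C ?g" by (intro blinfun_eqI) simp
      thus ?thesis by blast
    next
      case False
      \<comment> \<open>This \<open>z\<close> removes the term with \<open>p\<close> and isolates
        \<open>b (f x)\<close>, with a factor that does not depend on \<open>x\<close>.\<close>
      then obtain v z where z: "cinner (?g v) z = 0" "cinner (?g (c v)) z = 1"
        using orthogonal_vector_exists by metis
      have "b (f x) = (- cinner (?g (d v)) z) *\<^sub>C f x" for x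
        using pt [where v = v and x = x and z = z] by (simp add: z scaleC_one eq_neg_iff_add_eq_0)
      hence "b o\<^sub>L f = (- cinner (?g (d v)) z) *\<^sub>C f"
        by (intro blinfun_eqI) (simp add: blinfun.minus_left)
      thus ?thesis by blast
    qed
  }
  {
    fix p d
    assume S: "p \<in> \<A>" "d \<in> \<A>" and eq: "\<And>y. y \<in> corner f \<Longrightarrow> p o\<^sub>L y = y o\<^sub>L d"
    note bl = S [unfolded mem_algebra_iff]
    have pt: "cinner (?g v) z *\<^sub>C p (f x) = cinner (?g (d v)) z *\<^sub>C f x" for x z v
      using arg_cong [OF eq [OF rank_one_corner [OF f, of x z]], of "\<lambda>T. blinfun_apply T v"] bl f\<A>
      by (simp add: bounded_ops_scaleC)
    obtain z where z: "cinner (?g v0) z = 1"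
      using orthogonal_vector_exists [of "?g v0" 0] v0 by auto
    define s where "s = cinner (?g (d v0)) z"
    have ps: "p (f x) = s *\<^sub>C f x" for x
      using pt [where v = v0 and x = x and z = z] by (simp add: z s_def scaleC_one)
    have "?g (d v) = s *\<^sub>C ?g v" for v
    proof -
      let ?w = "?g (d v) - s *\<^sub>C ?g v"
      have "cinner (?g (d v)) z = s * cinner (?g v) z" for z
        using pt [where v = v and x = x0 and z = z] x0
        by (simp add: ps scaleC_scaleC mult.commute)
      hence "cinner ?w ?w = 0"
        by (simp add: cinner_diff_left cinner_scaleC_left)
      thus ?thesis by (simp add: cinner_self_eq_0_iff)
    qed
    with ps show "\<exists>s. p o\<^sub>L f = s *\<^sub>C f \<and> ?g o\<^sub>L d = s *\<^sub>C ?g"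
      by (intro exI [of _ s] conjI blinfun_eqI) simp_all
  }
next
  obtain N where N: "N \<in> \<M>" "N \<noteq> 0" "N \<noteq> E"
    using nontrivial by blast
  note NP = projectionsD [OF \<M>_proj [OF N(1)]]
  have NE: "N (E v) = N v" for v
  proof -
    have "cinner (N (E v)) y = cinner (N v) y" for y
      by (simp add: NP(3) projectionsD(3) [OF E] E_fixes [OF N(1)])
    hence "cinner (N (E v) - N v) (N (E v) - N v) = 0" by (simp add: cinner_diff_left)
    thus ?thesis by (simp add: cinner_self_eq_0_iff)
  qed
  \<comment> \<open>A nontrivial member of the chain is itself the triangular idempotent: it
    commutes with the chain in the required sense, and its range is invariant.\<close>
  have "N \<in> \<A>"
    unfolding mem_algebra_iff
  proof (intro conjI ballI allI impI)
    fix M v assume M: "M \<in> \<M>" and v: "M v = v"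
    note MP = projectionsD [OF \<M>_proj [OF M]]
    from chain [OF N(1) M] show "M (N v) = N v"
    proof
      assume "proj_le N M"
      thus ?thesis
        using NP(2) [of v] by (auto simp: proj_le_def subset_iff mem_ran_iff \<M>_proj N(1) M)
    next
      assume "proj_le M N"
      hence "N v = v"
        using v by (auto simp: proj_le_def subset_iff mem_ran_iff \<M>_proj N(1) M)
      thus ?thesis using v by simp
    qed
  qed (simp_all add: NP E_fixes N(1) NE)
  moreover have "N o\<^sub>L N = N"
    by (rule blinfun_eqI) (simp add: NP)
  moreover have "N o\<^sub>L y o\<^sub>L N = y o\<^sub>L N" if "y \<in> \<A>" for y
    using that [unfolded mem_algebra_iff] N(1) NP(2) by (intro blinfun_eqI) simp
  ultimately show "\<exists>f. tri_idem f"
    using N by (auto simp: tri_idem_def)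
qed

end

section \<open>Lie automorphisms of the direct sum\<close>

lemma commutator_dsum_mult:
  "commutator dsum_mult (A, a) (B, b) = (commutator (o\<^sub>L) A B, 0)"
  by (simp add: commutator_def dsum_mult_def)

context subspace_chain
begin

lemma lie_automorphism_dsum_decomposition:
  assumes \<psi>: "lie_automorphism dsum_mult (\<A> \<times> UNIV) \<psi>"
  shows "\<exists>\<epsilon> \<tau>\<^sub>1 \<tau>\<^sub>2 \<tau>.
    (alg_automorphism (o\<^sub>L) \<A> \<epsilon> \<or>
       (\<exists>\<phi>. alg_anti_automorphism (o\<^sub>L) \<A> \<phi> \<and> (\<forall>A\<in>\<A>. \<epsilon> A = - \<phi> A))) \<and>
    clinear_on UNIV (\<tau>\<^sub>2 :: complex \<Rightarrow> complex) \<and>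
    clinear_on \<A> \<tau>\<^sub>1 \<and> vanishes_on_commutators (o\<^sub>L) \<A> \<tau>\<^sub>1 \<and>
    clinear_on (\<A> \<times> UNIV) \<tau> \<and> vanishes_on_commutators dsum_mult (\<A> \<times> UNIV) \<tau> \<and>
    (\<forall>A\<in>\<A>. \<forall>a. \<psi> (A, a) = (\<epsilon> A + \<tau>\<^sub>1 A *\<^sub>C E, \<tau>\<^sub>2 a) + \<tau> (A, a) *\<^sub>C (E, 1))"
proof -
  have \<psi>_add: "\<psi> (A + B, a + b) = \<psi> (A, a) + \<psi> (B, b)" if "A \<in> \<A>" "B \<in> \<A>" for A B a b
  proof -
    have "\<psi> ((A, a) + (B, b)) = \<psi> (A, a) + \<psi> (B, b)"
      using \<psi> that unfolding lie_automorphism_def clinear_on_def by blast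
    thus ?thesis by simp
  qed
  have \<psi>_scale: "\<psi> (c *\<^sub>C A, c * a) = c *\<^sub>C \<psi> (A, a)" if "A \<in> \<A>" for c A a
  proof -
    have "\<psi> (c *\<^sub>C (A, a)) = c *\<^sub>C \<psi> (A, a)"
      using \<psi> that unfolding lie_automorphism_def clinear_on_def by blast
    thus ?thesis by (simp add: scaleC_prod_def scaleC_complex_def)
  qed
  have \<psi>_mem: "fst (\<psi> (A, a)) \<in> \<A>" if "A \<in> \<A>" for A a
    using \<psi> that unfolding lie_automorphism_def bij_betw_def by (metis SigmaI UNIV_I imageI mem_Times_iff)
  have \<psi>_surj: "\<exists>A\<in>\<A>. \<exists>a. \<psi> (A, a) = (B, b)" if "B \<in> \<A>" for B b
  proof -
    have "\<psi> ` (\<A> \<times> UNIV) = \<A> \<times> UNIV"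
      using \<psi> by (simp add: lie_automorphism_def bij_betw_def)
    hence "(B, b) \<in> \<psi> ` (\<A> \<times> UNIV)"
      using that by blast
    then obtain x where "x \<in> \<A> \<times> UNIV" "\<psi> x = (B, b)"
      by (elim imageE) simp
    thus ?thesis by (cases x) blast
  qed
  have \<psi>_inj: "A = B \<and> a = b" if "\<psi> (A, a) = \<psi> (B, b)" "A \<in> \<A>" "B \<in> \<A>" for A B a b
  proof -
    have "inj_on \<psi> (\<A> \<times> UNIV)" using \<psi> by (simp add: lie_automorphism_def bij_betw_def)
    thus ?thesis using that by (auto dest: inj_onD)
  qed
  \<comment> \<open>Commutators of the direct sum have second coordinate 0, since the scalars
    commute; hence the second coordinate of \<open>\<psi>\<close> vanishes on commutators.\<close>
  have \<psi>_bracket: "\<psi> (bracket A B, 0) = (bracket (fst (\<psi> (A, a))) (fst (\<psi> (B, b))), 0)"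
    if "A \<in> \<A>" "B \<in> \<A>" for A B a b
  proof -
    have "\<psi> (commutator dsum_mult (A, a) (B, b)) = commutator dsum_mult (\<psi> (A, a)) (\<psi> (B, b))"
      using \<psi> that by (simp add: lie_automorphism_def)
    thus ?thesis
      using commutator_dsum_mult [of "fst (\<psi> (A, a))" "snd (\<psi> (A, a))" "fst (\<psi> (B, b))" "snd (\<psi> (B, b))"]
      by (simp add: commutator_dsum_mult)
  qed
  have \<psi>_0: "\<psi> (0, 0) = (0, 0)"
    using \<psi>_add [of 0 0 0 0] by (simp add: zero_prod_def)
  have scalar_central: "bracket (c *\<^sub>C E) B = 0" if "B \<in> \<A>" for c B
    using that by (simp add: bracket_eq mult_simps)
  have \<psi>_scalar: "\<exists>s. fst (\<psi> (c *\<^sub>C E, a)) = s *\<^sub>C E" for c a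
  proof (rule central_imp_scalar)
    show "fst (\<psi> (c *\<^sub>C E, a)) \<in> \<A>" by (rule \<psi>_mem) simp
    fix B assume B: "B \<in> \<A>"
    then obtain C d where C: "C \<in> \<A>" "\<psi> (C, d) = (B, 0)" using \<psi>_surj by blast
    have "\<psi> (bracket (c *\<^sub>C E) C, 0) = (bracket (fst (\<psi> (c *\<^sub>C E, a))) B, 0)"
      using \<psi>_bracket [of "c *\<^sub>C E" C a d] C by simp
    thus "bracket (fst (\<psi> (c *\<^sub>C E, a))) B = 0"
      using scalar_central [OF C(1)] \<psi>_0 by simp
  qed
  have scalar_if_\<psi>_scalar: "\<exists>s. A = s *\<^sub>C E" if A: "A \<in> \<A>" and c: "fst (\<psi> (A, a)) = c *\<^sub>C E" for A a c
  proof (rule central_imp_scalar [OF A])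
    fix B assume B: "B \<in> \<A>"
    have "\<psi> (bracket A B, 0) = \<psi> (0, 0)"
      using \<psi>_bracket [OF A B, of a 0] scalar_central [OF \<psi>_mem [OF B]] by (simp add: c \<psi>_0)
    thus "bracket A B = 0" using \<psi>_inj A B by (metis bracket_mem zero_mem)
  qed
  define \<psi>\<^sub>1 where "\<psi>\<^sub>1 A = fst (\<psi> (A, 0))" for A
  define \<psi>\<^sub>2 where "\<psi>\<^sub>2 A = snd (\<psi> (A, 0))" for A
  have add1: "\<psi>\<^sub>1 (A + B) = \<psi>\<^sub>1 A + \<psi>\<^sub>1 B" and add2: "\<psi>\<^sub>2 (A + B) = \<psi>\<^sub>2 A + \<psi>\<^sub>2 B"
    if "A \<in> \<A>" "B \<in> \<A>" for A B
    using \<psi>_add [OF that, of 0 0] by (simp_all add: \<psi>\<^sub>1_def \<psi>\<^sub>2_def)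
  have scale1: "\<psi>\<^sub>1 (c *\<^sub>C A) = c *\<^sub>C \<psi>\<^sub>1 A" and scale2: "\<psi>\<^sub>2 (c *\<^sub>C A) = c * \<psi>\<^sub>2 A"
    if "A \<in> \<A>" for c A
    using \<psi>_scale [OF that, of c 0] by (simp_all add: \<psi>\<^sub>1_def \<psi>\<^sub>2_def scaleC_prod_def scaleC_complex_def)
  have bracket1: "\<psi>\<^sub>1 (bracket A B) = bracket (\<psi>\<^sub>1 A) (\<psi>\<^sub>1 B)" and bracket2: "\<psi>\<^sub>2 (bracket A B) = 0"
    if "A \<in> \<A>" "B \<in> \<A>" for A B
    using \<psi>_bracket [OF that, of 0 0] by (simp_all add: \<psi>\<^sub>1_def \<psi>\<^sub>2_def)
  have mem1 [simp]: "\<psi>\<^sub>1 A \<in> \<A>" if "A \<in> \<A>" for A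
    using \<psi>_mem [OF that] by (simp add: \<psi>\<^sub>1_def)
  obtain u where u: "\<psi>\<^sub>1 E = u *\<^sub>C E"
    using \<psi>_scalar [of 1 0] by (auto simp: \<psi>\<^sub>1_def scaleC_one)
  obtain \<mu> where \<mu>: "fst (\<psi> (0, 1)) = \<mu> *\<^sub>C E"
    using \<psi>_scalar [of 0 1] by auto
  define \<nu> where "\<nu> = snd (\<psi> (0, 1))"
  have \<psi>_eq: "\<psi> (A, a) = (\<psi>\<^sub>1 A + (a * \<mu>) *\<^sub>C E, \<psi>\<^sub>2 A + a * \<nu>)" if A: "A \<in> \<A>" for A a
  proof -
    have "\<psi> (A, a) = \<psi> (A, 0) + a *\<^sub>C \<psi> (0, 1)"
      using \<psi>_add [of A 0 0 a] \<psi>_scale [of 0 a 1] A by simp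
    thus ?thesis
      by (simp add: prod_eq_iff \<psi>\<^sub>1_def \<psi>\<^sub>2_def \<mu> \<nu>_def scaleC_prod_def scaleC_complex_def scaleC_scaleC)
  qed
  have E0: "E \<noteq> 0"
    using tri_idem_exists tri_idemD(1,3) unit_left by (metis mult_zero_left)
  \<comment> \<open>Chosen so that the corrected map does not kill \<open>E\<close>. If
    \<open>u = 0\<close>, injectivity of \<open>\<psi>\<close> makes the second coordinate at
    \<open>(E, 0)\<close> nonzero, so adding it repairs the defect.\<close>
  define t :: complex where "t = (if u = 0 then 1 else 0)"
  have w: "u + t * \<psi>\<^sub>2 E \<noteq> 0"
  proof (cases "u = 0")
    case True
    have "\<psi>\<^sub>2 E \<noteq> 0"
    proof
      assume "\<psi>\<^sub>2 E = 0"
      hence "\<psi> (E, 0) = \<psi> (0, 0)"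
        using \<psi>_eq [OF unit_mem, of 0] True u by (simp add: \<psi>_0)
      thus False using \<psi>_inj E0 by (metis unit_mem zero_mem)
    qed
    thus ?thesis by (simp add: t_def True)
  qed (simp add: t_def)
  define \<theta> where "\<theta> A = \<psi>\<^sub>1 A + (t * \<psi>\<^sub>2 A) *\<^sub>C E" for A
  have \<theta>_linear: "clinear_on \<A> \<theta>"
    by (simp add: clinear_on_def \<theta>_def add1 add2 scale1 scale2 scaleC_add_right scaleC_add_left
        scaleC_scaleC distrib_left mult.left_commute)
  have \<theta>_E: "\<theta> (c *\<^sub>C E) = (c * (u + t * \<psi>\<^sub>2 E)) *\<^sub>C E" for c
    by (simp add: \<theta>_def u scale1 scale2 scaleC_scaleC algebra_simps flip: scaleC_add_left)
  have \<theta>_bracket: "\<theta> (bracket A B) = bracket (\<theta> A) (\<theta> B)" if "A \<in> \<A>" "B \<in> \<A>" for A B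
    using that by (simp add: \<theta>_def bracket1 bracket2 bracket_shift)
  have \<theta>_diff_scale: "\<theta> (A - c *\<^sub>C B) = \<theta> A - c *\<^sub>C \<theta> B" if "A \<in> \<A>" "B \<in> \<A>" for A B c
  proof -
    have "\<theta> (A + (- c) *\<^sub>C B) = \<theta> A + (- c) *\<^sub>C \<theta> B"
      using \<theta>_linear that scale_mem unfolding clinear_on_def by metis
    thus ?thesis by simp
  qed
  have "inj_on \<theta> \<A>"
  proof (rule inj_onI)
    fix A B assume A: "A \<in> \<A>" and B: "B \<in> \<A>" and eq: "\<theta> A = \<theta> B"
    have 0: "\<theta> (A - B) = 0" using \<theta>_diff_scale [OF A B, of 1] eq by (simp add: scaleC_one)
    hence "\<psi>\<^sub>1 (A - B) = (- (t * \<psi>\<^sub>2 (A - B))) *\<^sub>C E"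
      by (simp add: \<theta>_def eq_neg_iff_add_eq_0)
    then obtain s where s: "A - B = s *\<^sub>C E"
      using scalar_if_\<psi>_scalar [OF diff_mem [OF A B]] unfolding \<psi>\<^sub>1_def by blast
    with 0 \<theta>_E [of s] w E0 have "s = 0" by (simp add: complex_vector.scale_eq_0_iff)
    with s show "A = B" by simp
  qed
  moreover have "\<theta> ` \<A> = \<A>"
  proof
    show "\<theta> ` \<A> \<subseteq> \<A>" by (auto simp: \<theta>_def)
    show "\<A> \<subseteq> \<theta> ` \<A>"
    proof
      fix B assume "B \<in> \<A>"
      then obtain A a where A: "A \<in> \<A>" "\<psi> (A, a) = (B, 0)" using \<psi>_surj by blast
      \<comment> \<open>The preimage under \<open>\<psi>\<close> may have a scalar part
        \<open>a\<close>, so \<open>\<theta> A\<close> misses \<open>B\<close> by a multiple of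
        \<open>E\<close>, which is then subtracted inside the argument.\<close>
      let ?k = "t * \<psi>\<^sub>2 A - a * \<mu>"
      have B: "\<theta> A = B + ?k *\<^sub>C E"
        using A(2) \<psi>_eq [OF A(1), of a] by (auto simp: \<theta>_def complex_vector.scale_left_diff_distrib)
      have "\<theta> (A - (?k / (u + t * \<psi>\<^sub>2 E)) *\<^sub>C E) = B"
        using \<theta>_diff_scale [OF A(1) unit_mem] \<theta>_E [of 1] w by (simp add: B scaleC_one scaleC_scaleC)
      thus "B \<in> \<theta> ` \<A>" using A(1) by (metis diff_mem scale_mem unit_mem imageI)
    qed
  qed
  ultimately have "lie_automorphism (o\<^sub>L) \<A> \<theta>"
    using \<theta>_linear \<theta>_bracket by (simp add: lie_automorphism_def bij_betw_def)
  then interpret triangular_lie_automorphism "(o\<^sub>L)" \<A> E \<theta>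
    by unfold_locales
  obtain \<epsilon> \<kappa> where \<epsilon>: "alg_automorphism (o\<^sub>L) \<A> \<epsilon> \<or> alg_anti_automorphism (o\<^sub>L) \<A> (\<lambda>A. - \<epsilon> A)"
    and \<kappa>: "clinear_on \<A> \<kappa>" and \<epsilon>\<theta>: "\<And>A. \<epsilon> A = \<theta> A + \<kappa> A *\<^sub>C E"
    using lie_automorphism_decomposition by blast
  have \<epsilon>_diff: "\<epsilon> (A - B) = \<epsilon> A - \<epsilon> B" if "A \<in> \<A>" "B \<in> \<A>" for A B
  proof -
    have "\<kappa> (A + (- 1) *\<^sub>C B) = \<kappa> A + (- 1) *\<^sub>C \<kappa> B"
      using \<kappa> that scale_mem unfolding clinear_on_def by metis
    hence "\<kappa> (A - B) = \<kappa> A - \<kappa> B" by (simp add: scaleC_one)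
    thus ?thesis
      using \<theta>_diff [OF that]
      by (simp add: \<epsilon>\<theta> scaleC_one complex_vector.scale_left_diff_distrib)
  qed
  \<comment> \<open>In both alternatives \<open>\<epsilon>\<close> preserves brackets; so does
    \<open>\<theta>\<close>, and the two have equal brackets of values because they differ by
    scalars.\<close>
  have \<kappa>_bracket: "\<kappa> (bracket A B) = 0" if A: "A \<in> \<A>" and B: "B \<in> \<A>" for A B
  proof -
    have "\<epsilon> (bracket A B) = \<epsilon> (A o\<^sub>L B) - \<epsilon> (B o\<^sub>L A)"
      using A B by (simp add: bracket_eq \<epsilon>_diff)
    also have "\<dots> = bracket (\<epsilon> A) (\<epsilon> B)"
      using \<epsilon>
    proof
      assume "alg_automorphism (o\<^sub>L) \<A> \<epsilon>"
      thus ?thesis using A B by (simp add: alg_automorphism_def bracket_eq)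
    next
      assume "alg_anti_automorphism (o\<^sub>L) \<A> (\<lambda>A. - \<epsilon> A)"
      hence "- \<epsilon> (A o\<^sub>L B) = \<epsilon> B o\<^sub>L \<epsilon> A" "- \<epsilon> (B o\<^sub>L A) = \<epsilon> A o\<^sub>L \<epsilon> B"
        using A B by (simp_all add: alg_anti_automorphism_def minus_left minus_right)
      hence "\<epsilon> (A o\<^sub>L B) = - (\<epsilon> B o\<^sub>L \<epsilon> A)" "\<epsilon> (B o\<^sub>L A) = - (\<epsilon> A o\<^sub>L \<epsilon> B)"
        by (metis minus_minus)+
      thus ?thesis by (simp add: bracket_eq)
    qed
    also have "\<dots> = \<theta> (bracket A B)"
      using A B by (simp add: \<epsilon>\<theta> bracket_shift \<theta>_bracket)
    finally have "\<kappa> (bracket A B) *\<^sub>C E = 0" by (simp add: \<epsilon>\<theta>)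
    with E0 show ?thesis by (simp add: complex_vector.scale_eq_0_iff)
  qed
  \<comment> \<open>\<open>\<tau>\<close> must carry the second coordinate's dependence on
    \<open>A\<close> and the first coordinate's dependence on \<open>a\<close>. Then
    \<open>\<tau>\<^sub>2\<close> corrects the latter in the second coordinate, and
    \<open>\<tau>\<^sub>1\<close> cancels all scalar terms in \<open>A\<close> in the first.\<close>
  let ?\<tau>\<^sub>2 = "\<lambda>a. a * (\<nu> - \<mu>)"
  let ?\<tau> = "\<lambda>x. \<psi>\<^sub>2 (fst x) + snd x * \<mu>"
  let ?\<tau>\<^sub>1 = "\<lambda>A. - \<kappa> A - t * \<psi>\<^sub>2 A - \<psi>\<^sub>2 A"
  show ?thesis
  proof (intro exI [of _ \<epsilon>] exI [of _ ?\<tau>\<^sub>1] exI [of _ ?\<tau>\<^sub>2] exI [of _ ?\<tau>] conjI ballI allI)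
    show "alg_automorphism (o\<^sub>L) \<A> \<epsilon> \<or>
        (\<exists>\<phi>. alg_anti_automorphism (o\<^sub>L) \<A> \<phi> \<and> (\<forall>A\<in>\<A>. \<epsilon> A = - \<phi> A))"
      using \<epsilon> by force
    show "clinear_on UNIV ?\<tau>\<^sub>2"
      by (simp add: clinear_on_def scaleC_complex_def algebra_simps)
    show "clinear_on \<A> ?\<tau>\<^sub>1"
      using \<kappa> by (simp add: clinear_on_def add2 scale2 scaleC_complex_def algebra_simps)
    show "vanishes_on_commutators (o\<^sub>L) \<A> ?\<tau>\<^sub>1"
      by (simp add: vanishes_on_commutators_def \<kappa>_bracket bracket2)
    show "clinear_on (\<A> \<times> UNIV) ?\<tau>"
      by (simp add: clinear_on_def add2 scale2 scaleC_prod_def scaleC_complex_def algebra_simps)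
    show "vanishes_on_commutators dsum_mult (\<A> \<times> UNIV) ?\<tau>"
      by (simp add: vanishes_on_commutators_def commutator_dsum_mult bracket2)
    show "\<psi> (A, a) = (\<epsilon> A + ?\<tau>\<^sub>1 A *\<^sub>C E, ?\<tau>\<^sub>2 a) + ?\<tau> (A, a) *\<^sub>C (E, 1)" if "A \<in> \<A>" for A a
      using that by (simp add: \<psi>_eq \<epsilon>\<theta> \<theta>_def scaleC_prod_def scaleC_complex_def
          scaleC_add_left complex_vector.scale_left_diff_distrib algebra_simps)
  qed
qed

end

theorem theorem3:
  fixes \<N> :: "('a::complex_hilbert \<Rightarrow>\<^sub>L 'a) set"
    and \<xi> :: 'a
    and \<psi> :: "('a \<Rightarrow>\<^sub>L 'a) \<times> complex \<Rightarrow> ('a \<Rightarrow>\<^sub>L 'a) \<times> complex"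
  defines "E \<equiv> I_minus \<N>"
  defines "\<N>\<^sub>1 \<equiv> {N \<in> \<N>. proj_le N E}"
  defines "\<T> \<equiv> nest_algebra E \<N>\<^sub>1"
  assumes "infinite_cdim TYPE('a)"
    and "separable_space (euclidean :: 'a topology)"
    and "nest \<N>"
    and "\<exists>F\<subseteq>\<N>. card F = 4"
    and "separating \<xi> (commutant (commutant \<N>))"
    and "proj_less E id_blinfun"
    and "proj_Sup {E, proj_vec \<xi>} = id_blinfun"
    and "lie_automorphism dsum_mult (\<T> \<times> UNIV) \<psi>"
  shows "\<exists>\<epsilon> \<tau>\<^sub>1 \<tau>\<^sub>2 \<tau>.
    (alg_automorphism (o\<^sub>L) \<T> \<epsilon> \<or>
       (\<exists>\<phi>. alg_anti_automorphism (o\<^sub>L) \<T> \<phi> \<and> (\<forall>A\<in>\<T>. \<epsilon> A = - \<phi> A))) \<and>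
    clinear_on UNIV (\<tau>\<^sub>2 :: complex \<Rightarrow> complex) \<and>
    clinear_on \<T> \<tau>\<^sub>1 \<and> vanishes_on_commutators (o\<^sub>L) \<T> \<tau>\<^sub>1 \<and>
    clinear_on (\<T> \<times> UNIV) \<tau> \<and> vanishes_on_commutators dsum_mult (\<T> \<times> UNIV) \<tau> \<and>
    (\<forall>A\<in>\<T>. \<forall>a. \<psi> (A, a) = (\<epsilon> A + \<tau>\<^sub>1 A *\<^sub>C E, \<tau>\<^sub>2 a) + \<tau> (A, a) *\<^sub>C (E, 1))"
proof -
  obtain F where F: "F \<subseteq> \<N>" "card F = 4"
    using assms(7) by blast
  \<comment> \<open>Four projections cannot fit among these three; a further one is strictly below
    the identity, hence below \<open>E\<close>, and is a nontrivial member of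
    \<open>\<N>\<^sub>1\<close>.\<close>
  have "\<not> F \<subseteq> {0, id_blinfun, E}"
  proof
    assume "F \<subseteq> {0, id_blinfun, E}"
    hence "card F \<le> card {0, id_blinfun, E}" by (rule card_mono [rotated]) simp
    also have "\<dots> \<le> 3" by (simp add: card_insert_if)
    finally show False using F(2) by simp
  qed
  then obtain N where N: "N \<in> \<N>" "N \<noteq> 0" "N \<noteq> id_blinfun" "N \<noteq> E"
    using F(1) by blast
  have "ran (id_blinfun :: 'a \<Rightarrow>\<^sub>L 'a) = UNIV"
    by (simp add: ran_def)
  hence "proj_less N id_blinfun"
    using N(3) by (simp add: proj_less_def proj_le_def)
  hence "N \<in> \<N>\<^sub>1"
    using N(1) by (simp add: \<N>\<^sub>1_def E_def I_minus_def proj_le_proj_Sup)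
  interpret subspace_chain E \<N>\<^sub>1
  proof
    show "E \<in> projections"
      unfolding E_def I_minus_def by (rule proj_Sup_projection)
    show "\<exists>N\<in>\<N>\<^sub>1. N \<noteq> 0 \<and> N \<noteq> E"
      using N \<open>N \<in> \<N>\<^sub>1\<close> by blast
  qed (use assms(6) in \<open>auto simp: \<N>\<^sub>1_def nest_def\<close>)
  show ?thesis
    using lie_automorphism_dsum_decomposition assms(11) unfolding \<T>_def by blast
qed

end
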